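(* If $q$ is a power of a prime, $m$ is a positive integer, and $\delta$ is an integer in the range $$2\le\delta\le\delta_{\max}=q^{m+[m\text{ even}]}-1-(q^2-2)[m\text{ even}],$$ then there exists a subsystem code $Q$ with parameters $$[[q^{2m}-1,\;q^{2m}-1-2m\lceil(\delta-1)(1-1/q^2)\rceil-r,\;r,\;d_Q\ge\delta]]_q$$ that is pure up to $\delta$, where $0\le r<q^{2m}-1-2m\lceil(\delta-1)(1-1/q^2)\rceil$ (i.e. for every integer $r$ in this range).
   Context: $[P]$ is $1$ if $P$ is true and $0$ otherwise. Subsystem codes: let $p$ be the characteristic of $\mathbf{F}_q$. For $(x|y)\in\mathbf{F}_q^{2n}$ (with $x,y\in\mathbf{F}_q^n$), $\mathrm{swt}(x|y)$ is the number of $i$ with $(x_i,y_i)\ne(0,0)$, and $\mathrm{swt}(S)$ is the minimum of $\mathrm{swt}$ over the nonzero elements of $S$. The trace-symplectic product of $(a|b)$ and $(a'|b')$ is $\mathrm{tr}_{q/p}(a'\cdot b-a\cdot b')$, and $C^{\perp_s}$ is the dual of $C\subseteq\mathbf{F}_q^{2n}$ with respect to it. All subsystem codes are Clifford subsystem codes: an $((n,K,R,d))_q$ subsystem code is a subspace $Q=A\otimes B$ of $\mathbf{C}^{q^n}$, $\dim A=K$, $\dim B=R$, arising from an additive code; concretely, its existence means that there is an additive subgroup $C\le\mathbf{F}_q^{2n}$ (the zero code is allowed) with $D=C\cap C^{\perp_s}$ such that $|C|=q^nR/K$, $|D|=q^n/(KR)$, and $d=\mathrm{swt}(D^{\perp_s}\setminus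 C)$ if $D^{\perp_s}\ne C$, while $d=\mathrm{swt}(D^{\perp_s})$ if $D^{\perp_s}=C$ (the case $K=1$). $[[n,k,r,d]]_q$ means $((n,q^k,q^r,d))_q$. The code derived from $C$ is pure to (pure up to) $\delta$ if $C$ contains no nonzero element of symplectic weight less than $\delta$. *)

theory Defs
  imports
    "HOL-Library.Cardinality"
    "HOL-Computational_Algebra.Computational_Algebra"
    "HOL-Algebra.AbelCoset"
    "Jordan_Normal_Form.Matrix"
begin

text \<open>
  The alphabet is a finite field given as a type \<open>'a\<close> of class \<open>finite_field\<close>. A vector
  $(x|y) \in \mathbf{F}_q^{2n}$ is a vector of dimension \<open>2 * n\<close>: \<open>x\<close> occupies the
  coordinates \<open>0, ..., n - 1\<close> and \<open>y\<close> the coordinates \<open>n, ..., 2 * n - 1\<close>.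
\<close>

text \<open>
  The exponent \<open>multiplicity CHAR('a) CARD('a)\<close> is the \<open>e\<close> with $q = p^e$, so this is
  $x + x^p + \dots + x^{p^{e-1}}$. The value lies in the prime field, viewed inside \<open>'a\<close>.
\<close>
definition field_tr :: "'a :: finite_field \<Rightarrow> 'a" where
  "field_tr x = (\<Sum>i<multiplicity CHAR('a) CARD('a). x ^ (CHAR('a) ^ i))"

definition trace_symplectic :: "nat \<Rightarrow> 'a :: finite_field vec \<Rightarrow> 'a vec \<Rightarrow> 'a" where
  "trace_symplectic n v w =
     field_tr (vec_first w n \<bullet> vec_last v n - vec_first v n \<bullet> vec_last w n)"

definition symplectic_dual :: "nat \<Rightarrow> 'a :: finite_field vec set \<Rightarrow> 'a vec set" where
  "symplectic_dual n C = {v \<in> carrier_vec (2 * n). \<forall>c\<in>C. trace_symplectic n v c = 0}"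

definition swt :: "nat \<Rightarrow> 'a :: zero vec \<Rightarrow> nat" where
  "swt n v = card {i. i < n \<and> (v $ i, v $ (n + i)) \<noteq> (0, 0)}"

text \<open>
  \<open>Min\<close> is unspecified on the empty set, so this is only meaningful if \<open>S\<close> has a nonzero
  element. In \<open>is_subsystem_code\<close> below that is always the case for \<open>n > 0\<close>.
\<close>
definition swt_set :: "nat \<Rightarrow> 'a :: zero vec set \<Rightarrow> nat" where
  "swt_set n S = Min (swt n ` (S - {0\<^sub>v (2 * n)}))"

text \<open>
  The additive code \<open>C\<close> gives rise to a Clifford subsystem code with parameters
  $((n, K, R, d))_q$, where $q$ is \<open>CARD('a)\<close>. The quotients are real, not truncated.
\<close>
definition is_subsystem_code ::
  "nat \<Rightarrow> nat \<Rightarrow> nat \<Rightarrow> nat \<Rightarrow> 'a :: finite_field vec set \<Rightarrow> bool" where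
  "is_subsystem_code n K R d C \<longleftrightarrow>
     additive_subgroup C (module_vec TYPE('a) (2 * n)) \<and>
     (let D = C \<inter> symplectic_dual n C; E = symplectic_dual n D in
        real (card C) = real CARD('a) ^ n * real R / real K \<and>
        real (card D) = real CARD('a) ^ n / (real K * real R) \<and>
        d = (if E \<noteq> C then swt_set n (E - C) else swt_set n E))"

text \<open>Parameters $[[n, k, r, d]]_q = ((n, q^k, q^r, d))_q$.\<close>
definition is_subsystem_code_dim ::
  "nat \<Rightarrow> nat \<Rightarrow> nat \<Rightarrow> nat \<Rightarrow> 'a :: finite_field vec set \<Rightarrow> bool" where
  "is_subsystem_code_dim n k r d C \<longleftrightarrow> is_subsystem_code n (CARD('a) ^ k) (CARD('a) ^ r) d C"

definition pure_to :: "nat \<Rightarrow> nat \<Rightarrow> 'a :: zero vec set \<Rightarrow> bool" where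
  "pure_to n \<delta> C \<longleftrightarrow> (\<forall>c\<in>C. c \<noteq> 0\<^sub>v (2 * n) \<longrightarrow> \<not> swt n c < \<delta>)"

end

theory Submission
  imports Defs
    "HOL-Algebra.Algebraic_Closure_Type"
    "HOL-Number_Theory.Residues"
    "HOL-Library.Function_Algebras"
begin

text \<open>
  Let $L = \mathbf{F}_{q^{2m}}$, with nonzero elements $\alpha_i$, let
  $\gamma \in \mathbf{F}_{q^2} \setminus \mathbf{F}_q$, and let $c = (f(\alpha_i))_i$ for a
  polynomial $f$ over $L$ whose exponents lie in $[1, \delta)$ and are not divisible by $q^2$. The
  vectors $(\mathrm{tr}(c) | \mathrm{tr}(\gamma c))$ form a code over $\mathbf{F}_q$ whose
  symplectic dual is the narrow-sense BCH code over $\mathbf{F}_{q^2}$ of designed distance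
  $\delta$. The bound on $\delta$ ensures that $q^{2m} - 1$ does not divide $j q^s + k q^t$ for
  exponents $j, k$ and odd $s + t$. Hence the power sums $\sum_i \alpha_i^{j q^s + k q^t}$ vanish
  and the code is isotropic.

  It has dimension at most $2m\lceil(\delta-1)(1-1/q^2)\rceil$, with strict inequality possible
  because cyclotomic cosets may coincide or be short for even $m$. An isotropic extension $D$ of
  exactly this dimension still has dual distance at least $\delta$, so the dimension of the BCH
  code is not needed. Adding $r$ hyperbolic pairs to $D$ gives the required code $C$ with
  $D = C \cap C^\perp$ and $C \subseteq D^\perp$.
\<close>

hide_const (open) up_ring.monom up_ring.coeff module.smult Polynomials.degree Polynomials.lead_coeff

section \<open>Finite subfields of the algebraic closure\<close>

lemma card_finite_field_gt_1: "CARD('a :: finite_field) > 1"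
proof -
  have "card {0, 1 :: 'a} \<le> CARD('a)"
    by (rule card_mono) auto
  thus ?thesis by simp
qed

text \<open>
  The polynomial $(X + 1)^q - X^q - 1$ has degree less than $q$ and vanishes on the whole field.
\<close>
lemma of_nat_choose_CARD_eq_0:
  assumes "0 < i" "i < CARD('a :: finite_field)"
  shows "(of_nat (CARD('a) choose i) :: 'a) = 0"
proof -
  let ?q = "CARD('a)"
  define P :: "'a poly" where "P = (\<Sum>i\<in>{0<..<?q}. monom (of_nat (?q choose i)) i)"
  have "poly P x = 0" for x
  proof -
    have "x + 1 = (x + 1) ^ ?q" by (rule finite_field_power_card_eq_same[symmetric])
    also have "\<dots> = (\<Sum>k\<le>?q. of_nat (?q choose k) * x ^ k)"
      by (simp add: binomial_ring)
    also have "{..?q} = insert 0 (insert ?q {0<..<?q})" by auto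
    also have "(\<Sum>k\<in>\<dots>. of_nat (?q choose k) * x ^ k) = 1 + (x ^ ?q + poly P x)"
      by (simp add: P_def poly_sum poly_monom)
    also have "x ^ ?q = x" by (rule finite_field_power_card_eq_same)
    finally show ?thesis by simp
  qed
  moreover have "degree P < ?q"
    unfolding P_def by (intro degree_sum_less) (auto intro: le_less_trans[OF degree_monom_le])
  ultimately have "P = 0"
    using card_poly_roots_bound[of P] by auto
  then have "0 = coeff P i" by simp
  also have "\<dots> = of_nat (?q choose i)"
    using assms by (simp add: P_def coeff_sum coeff_monom)
  finally show ?thesis by simp
qed

text \<open>The inner binomial coefficients vanish in the base field, hence also in its closure
  through \<open>to_ac\<close>. This gives additivity of the q-th power, and iteration gives the
  rest.\<close>

lemma alg_closure_frobenius_add: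
  fixes x y :: "'a :: finite_field alg_closure"
  shows "(x + y) ^ (CARD('a) ^ j) = x ^ (CARD('a) ^ j) + y ^ (CARD('a) ^ j)"
proof (induction j)
  case (Suc j)
  let ?q = "CARD('a)"
  have 1: "(u + v) ^ ?q = u ^ ?q + v ^ ?q" for u v :: "'a alg_closure"
  proof -
    have "(u + v) ^ ?q = (\<Sum>k\<le>?q. of_nat (?q choose k) * u ^ k * v ^ (?q - k))"
      by (rule binomial_ring)
    also have "\<dots> = (\<Sum>k\<in>{0, ?q}. of_nat (?q choose k) * u ^ k * v ^ (?q - k))"
    proof (intro sum.mono_neutral_right ballI)
      fix k assume "k \<in> {..?q} - {0, ?q}"
      then have "(of_nat (?q choose k) :: 'a) = 0"
        by (intro of_nat_choose_CARD_eq_0) auto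
      then have "to_ac (of_nat (?q choose k) :: 'a) = 0" by simp
      then show "of_nat (?q choose k) * u ^ k * v ^ (?q - k) = 0" by simp
    qed auto
    finally show ?thesis by (simp add: add.commute)
  qed
  have "(x + y) ^ (?q ^ Suc j) = ((x + y) ^ (?q ^ j)) ^ ?q"
    by (simp only: power_Suc2 power_mult)
  also have "\<dots> = (x ^ (?q ^ j)) ^ ?q + (y ^ (?q ^ j)) ^ ?q"
    by (simp only: Suc 1)
  finally show ?case by (simp only: power_Suc2 power_mult)
qed simp

lemma alg_closure_frobenius_sum:
  fixes f :: "'b \<Rightarrow> 'a :: finite_field alg_closure"
  shows "(\<Sum>i\<in>A. f i) ^ (CARD('a) ^ j) = (\<Sum>i\<in>A. f i ^ (CARD('a) ^ j))"
  by (induction A rule: infinite_finite_induct) (auto simp: alg_closure_frobenius_add power_0_left)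

lemma alg_closure_frobenius_diff:
  fixes x y :: "'a :: finite_field alg_closure"
  shows "(x - y) ^ (CARD('a) ^ j) = x ^ (CARD('a) ^ j) - y ^ (CARD('a) ^ j)"
  using alg_closure_frobenius_add[of "x - y" y j] by simp

section \<open>Roots of unity and their power sums\<close>

text \<open>\<open>X^n - 1\<close> splits into linear factors. A repeated root would also be a root
  of the derivative \<open>n * X^(n-1)\<close>, hence 0, which is not a root. So the
  \<open>n\<close> roots are distinct.\<close>

lemma card_roots_of_unity:
  assumes "(of_nat n :: 'k :: alg_closed_field) \<noteq> 0"
  shows "card {x :: 'k. x ^ n = 1} = n"
proof -
  have n: "n > 0" using assms by (cases n) auto
  define p :: "'k poly" where "p = monom 1 n - 1"
  have coeff_n: "coeff p n = 1" using n by (simp add: p_def)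
  have "degree p \<le> n" unfolding p_def by (intro degree_diff_le) (auto simp: degree_monom_le)
  with coeff_n have deg: "degree p = n" by (metis antisym le_degree zero_neq_one)
  have p0: "p \<noteq> 0" using coeff_n by auto
  have roots: "poly p x = 0 \<longleftrightarrow> x ^ n = 1" for x
    by (simp add: p_def poly_monom)
  obtain A where A: "size A = degree p" "p = smult (lead_coeff p) (\<Prod>x\<in>#A. [:-x, 1:])"
    using alg_closed_imp_factorization[OF p0] by blast
  have lc: "lead_coeff p = 1" using deg coeff_n by simp
  have p_eq: "p = (\<Prod>x\<in>#A. [:-x, 1:])" using A(2) unfolding lc by simp
  have "count A x \<le> 1" for x
  proof (rule ccontr)
    assume "\<not> count A x \<le> 1"
    then have "2 \<le> count A x" by simp
    then have "x \<in># A" by (metis count_inI not_numeral_le_zero)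
    then obtain B' where B': "A = add_mset x B'" by (blast dest: multi_member_split)
    with \<open>2 \<le> count A x\<close> have "count B' x \<noteq> 0" by simp
    then have "x \<in># B'" by (metis count_inI)
    then obtain B where B: "A = add_mset x (add_mset x B)"
      unfolding B' by (blast dest: multi_member_split)
    define r where "r = (\<Prod>x\<in>#B. [:-x, 1:])"
    have p_r: "p = [:-x, 1:] * ([:-x, 1:] * r)" using p_eq by (simp add: B r_def)
    have "poly (pderiv p) x = 0" unfolding p_r pderiv_mult by simp
    then have "of_nat n * x ^ (n - 1) = 0" by (simp add: p_def pderiv_diff pderiv_monom poly_monom)
    with assms have "x = 0" by auto
    moreover have "x ^ n = 1" using roots[of x] by (simp add: p_r)
    ultimately show False using n by (simp add: power_0_left)
  qed
  then have "A = mset_set (set_mset A)"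
    by (intro multiset_eqI) (metis count_eq_zero_iff count_mset_set(1) count_mset_set(3) finite_set_mset
        le_antisym less_one linorder_not_le)
  then have "card (set_mset A) = n" using A(1) deg by (metis size_mset_set)
  moreover have "set_mset A = {x. x ^ n = 1}"
  proof -
    have "0 \<in> (-) x ` set_mset A \<longleftrightarrow> x \<in># A" for x
      by (auto simp: image_iff)
    then have "x \<in># A \<longleftrightarrow> x ^ n = 1" for x
      using roots[of x] by (simp add: p_eq poly_prod_mset prod_mset_zero_iff)
    then show ?thesis by auto
  qed
  ultimately show ?thesis by simp
qed

text \<open>Multiplication by a root \<open>y\<close> permutes the roots, so the sum equals
  \<open>y ^ k\<close> times itself. Some \<open>y\<close> has \<open>y ^ k \<noteq> 1\<close>:
  otherwise the nonzero polynomial \<open>X^(k mod n) - 1\<close>, of degree less than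
  \<open>n\<close>, would have \<open>n\<close> roots.\<close>

lemma sum_roots_of_unity_power_eq_0:
  fixes n k :: nat
  assumes card: "card {x :: 'k :: field. x ^ n = 1} = n" and n: "n > 0" and k: "\<not> n dvd k"
  shows "(\<Sum>x | x ^ n = (1 :: 'k). x ^ k) = 0"
proof -
  let ?U = "{x :: 'k. x ^ n = 1}"
  have "\<exists>y\<in>?U. y ^ k \<noteq> 1"
  proof (rule ccontr)
    assume "\<not> ?thesis"
    then have all: "y ^ k = 1" if "y \<in> ?U" for y using that by blast
    have k': "0 < k mod n" "k mod n < n" using k n by (auto simp: dvd_eq_mod_eq_0)
    define p :: "'k poly" where "p = monom 1 (k mod n) - 1"
    have coeff: "coeff p (k mod n) = 1" using k' by (simp add: p_def)
    then have p0: "p \<noteq> 0" by auto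
    have deg: "degree p \<le> k mod n"
      unfolding p_def by (intro degree_diff_le) (auto simp: degree_monom_le)
    have "poly p y = 0" if "y \<in> ?U" for y
    proof -
      have "1 = y ^ (n * (k div n) + k mod n)" using all[OF that] by simp
      also have "\<dots> = y ^ (k mod n)" using that by (simp only: power_add power_mult) simp
      finally show ?thesis by (simp add: p_def poly_monom)
    qed
    then have "card ?U \<le> card {y. poly p y = 0}"
      by (intro card_mono poly_roots_finite p0) auto
    also have "\<dots> \<le> k mod n" using card_poly_roots_bound[OF p0] deg by simp
    finally show False using k' card by simp
  qed
  then obtain y :: 'k where y: "y ^ n = 1" "y ^ k \<noteq> 1" by blast
  have y0: "y \<noteq> 0" using y n by (auto simp: power_0_left)
  have "(\<Sum>x\<in>?U. x ^ k) = (\<Sum>x\<in>?U. (y * x) ^ k)"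
    using y y0 by (intro sum.reindex_bij_witness[of _ "\<lambda>x. y * x" "\<lambda>x. x / y"])
      (auto simp: power_mult_distrib power_divide)
  also have "\<dots> = y ^ k * (\<Sum>x\<in>?U. x ^ k)"
    by (simp add: power_mult_distrib sum_distrib_left)
  finally show ?thesis using y(2) by simp
qed

text \<open>The trace polynomial is nonzero of degree at most \<open>B ^ (d - 1)\<close>, so it has
  too few roots to vanish on \<open>S\<close>. This serves the absolute trace of the alphabet as
  well as the relative trace from \<open>L\<close>.\<close>

lemma exists_nonzero_trace_polynomial:
  fixes S :: "'k :: field set"
  assumes "d > 0" "B > 1" "finite S" "card S > B ^ (d - 1)"
  shows "\<exists>x\<in>S. (\<Sum>t<d. x ^ (B ^ t)) \<noteq> 0"
proof (rule ccontr)
  assume contra: "\<not> ?thesis"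
  define P :: "'k poly" where "P = (\<Sum>t<d. monom 1 (B ^ t))"
  have "coeff P (B ^ (d - 1)) = (\<Sum>t<d. if t = d - 1 then 1 else 0)"
    using assms(2) by (auto simp: P_def coeff_sum coeff_monom intro!: sum.cong)
  also have "\<dots> = 1" using assms(1) by simp
  finally have P0: "P \<noteq> 0" by auto
  have "degree P \<le> B ^ (d - 1)"
    unfolding P_def using assms(2)
    by (intro degree_sum_le) (auto intro!: order_trans[OF degree_monom_le] power_increasing)
  moreover have "card S \<le> card {x. poly P x = 0}"
    using contra by (intro card_mono poly_roots_finite P0) (auto simp: P_def poly_sum poly_monom)
  ultimately show False
    using card_poly_roots_bound[OF P0] assms(4) by linarith
qed

text \<open>With e the exponent of p in q, \<open>p^(e-1) < p^e \<le> q\<close>, so the trace has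
  fewer zeros than the field has elements.\<close>

lemma field_tr_not_zero: "\<exists>x :: 'a :: finite_field. field_tr x \<noteq> 0"
proof -
  let ?e = "multiplicity CHAR('a) CARD('a)"
  have p: "CHAR('a) > 1" using CHAR_prime[where ?'a = 'a] prime_gt_1_nat by blast
  have dvd: "CHAR('a) dvd CARD('a)" by (rule CHAR_dvd_CARD)
  then have e: "?e > 0"
    using p by (simp add: multiplicity_gt_zero_iff)
  have "CHAR('a) ^ (?e - 1) < CHAR('a) ^ ?e" using p e by (intro power_strict_increasing) auto
  also have "\<dots> \<le> CARD('a)" by (intro dvd_imp_le multiplicity_dvd) auto
  finally show ?thesis
    using exists_nonzero_trace_polynomial[OF e p, of "UNIV :: 'a set"] by (auto simp: field_tr_def)
qed

section \<open>Subfields as fixed points of powers of Frobenius\<close>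

text \<open>For \<open>d > 0\<close> this is the field with \<open>q^d\<close> elements. The base
  field, its quadratic extension and \<open>L\<close> thus all live inside one type, and inclusions
  come from divisibility of \<open>d\<close>.\<close>

definition frob_fixed :: "nat \<Rightarrow> 'a :: finite_field alg_closure set" where
  "frob_fixed d = {x. x ^ (CARD('a) ^ d) = x}"

text \<open>Since \<open>q^d\<close> is 0 in the closure, \<open>q^d - 1\<close> is -1 there and
  hence nonzero, as the count of roots requires.\<close>

lemma card_roots_of_unity_frob:
  assumes "d > 0"
  shows "card {x :: 'a :: finite_field alg_closure. x ^ (CARD('a) ^ d - 1) = 1} = CARD('a) ^ d - 1"
proof (rule card_roots_of_unity)
  have "(of_nat (CARD('a) ^ d) :: 'a) = 0"
    using assms CHAR_dvd_CARD[where ?'a = 'a]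
    unfolding of_nat_eq_0_iff_char_dvd by (metis dvd_power dvd_trans)
  then have "to_ac (of_nat (CARD('a) ^ d) :: 'a) = 0" by (simp only: to_ac_0)
  then have "of_nat (CARD('a) ^ d) = (0 :: 'a alg_closure)" by (simp only: to_ac_of_nat)
  then have eq: "(of_nat (CARD('a) ^ d - 1) :: 'a alg_closure) = -1"
    using of_nat_diff[of 1 "CARD('a) ^ d", where ?'a = "'a alg_closure"]
    by (simp add: Suc_le_eq del: of_nat_power)
  show "(of_nat (CARD('a) ^ d - 1) :: 'a alg_closure) \<noteq> 0"
    unfolding eq by simp
qed

lemma frob_fixed_eq:
  "frob_fixed d = insert 0 {x :: 'a :: finite_field alg_closure. x ^ (CARD('a) ^ d - 1) = 1}"
proof -
  have "x ^ (CARD('a) ^ d) = x \<longleftrightarrow> x ^ (CARD('a) ^ d - 1) = 1" if "x \<noteq> 0" for x :: "'a alg_closure"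
  proof -
    have "x ^ (CARD('a) ^ d) = x * x ^ (CARD('a) ^ d - 1)"
      by (subst power_Suc[symmetric]) simp
    with that show ?thesis by simp
  qed
  moreover have "(0 :: 'a alg_closure) ^ (CARD('a) ^ d) = 0" by simp
  ultimately have "x ^ (CARD('a) ^ d) = x \<longleftrightarrow> x = 0 \<or> x ^ (CARD('a) ^ d - 1) = 1" for x :: "'a alg_closure"
    by metis
  then show ?thesis by (auto simp only: frob_fixed_def)
qed

lemma card_frob_fixed:
  assumes "d > 0"
  shows "card (frob_fixed d :: 'a :: finite_field alg_closure set) = CARD('a) ^ d"
proof -
  have q: "CARD('a) ^ d > 1" using assms card_finite_field_gt_1[where ?'a = 'a] by (intro one_less_power)
  let ?U = "{x :: 'a alg_closure. x ^ (CARD('a) ^ d - 1) = 1}"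
  have "card ?U = CARD('a) ^ d - 1" by (rule card_roots_of_unity_frob[OF assms])
  moreover from this have "finite ?U" using q by (intro card_ge_0_finite) simp
  ultimately show ?thesis
    unfolding frob_fixed_eq using q by (subst card_insert_disjoint) (auto simp: power_0_left)
qed

lemma finite_frob_fixed: "d > 0 \<Longrightarrow> finite (frob_fixed d :: 'a :: finite_field alg_closure set)"
  by (intro card_ge_0_finite) (simp add: card_frob_fixed)

text \<open>Every element of the base field is fixed by the q-th power, and both sets have q
  elements. Hence fixed elements can be pulled back to the alphabet.\<close>

lemma range_to_ac: "range to_ac = (frob_fixed 1 :: 'a :: finite_field alg_closure set)"
proof (rule card_subset_eq)
  show "range to_ac \<subseteq> (frob_fixed 1 :: 'a alg_closure set)"
    by (auto simp: frob_fixed_def finite_field_power_card_eq_same simp flip: to_ac_power)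
  show "card (range (to_ac :: 'a \<Rightarrow> _)) = card (frob_fixed 1 :: 'a alg_closure set)"
    using card_image[OF inj_to_ac[where ?'a = 'a]] by (simp add: card_frob_fixed)
qed (simp add: finite_frob_fixed)

lemma frob_fixed_closed:
  fixes x y :: "'a :: finite_field alg_closure"
  shows frob_fixed_0: "(0 :: 'a alg_closure) \<in> frob_fixed d"
    and frob_fixed_add: "x \<in> frob_fixed d \<Longrightarrow> y \<in> frob_fixed d \<Longrightarrow> x + y \<in> frob_fixed d"
    and frob_fixed_diff: "x \<in> frob_fixed d \<Longrightarrow> y \<in> frob_fixed d \<Longrightarrow> x - y \<in> frob_fixed d"
    and frob_fixed_mult: "x \<in> frob_fixed d \<Longrightarrow> y \<in> frob_fixed d \<Longrightarrow> x * y \<in> frob_fixed d"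
    and frob_fixed_divide: "x \<in> frob_fixed d \<Longrightarrow> y \<in> frob_fixed d \<Longrightarrow> x / y \<in> frob_fixed d"
    and frob_fixed_power: "x \<in> frob_fixed d \<Longrightarrow> x ^ k \<in> frob_fixed d"
  by (auto simp: frob_fixed_def alg_closure_frobenius_add alg_closure_frobenius_diff
      power_mult_distrib power_divide power_0_left)
    (metis power_mult mult.commute)

lemma frob_fixed_sum:
  "(\<And>i. i \<in> A \<Longrightarrow> f i \<in> frob_fixed d) \<Longrightarrow> (\<Sum>i\<in>A. f i) \<in> frob_fixed d"
  by (induction A rule: infinite_finite_induct) (auto simp: frob_fixed_0 frob_fixed_add)

lemma frob_fixed_dvd:
  assumes "x \<in> frob_fixed d"
  shows "x ^ (CARD('a :: finite_field) ^ (d * k)) = (x :: 'a alg_closure)"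
proof (induction k)
  case (Suc k)
  have "x ^ (CARD('a) ^ (d * Suc k)) = (x ^ (CARD('a) ^ (d * k))) ^ (CARD('a) ^ d)"
    by (simp add: power_add mult.commute flip: power_mult)
  with Suc assms show ?case by (simp add: frob_fixed_def)
qed simp

lemma frob_fixed_mono:
  assumes "d dvd d'"
  shows "frob_fixed d \<subseteq> (frob_fixed d' :: 'a :: finite_field alg_closure set)"
  using assms frob_fixed_dvd by (auto simp: frob_fixed_def[of d'] elim!: dvdE)

lemma to_ac_frob_fixed: "to_ac (x :: 'a :: finite_field) \<in> frob_fixed d"
  using frob_fixed_mono[of 1 d] range_to_ac by auto

section \<open>The relative trace\<close>

text \<open>On \<open>frob_fixed d\<close> with \<open>d > 0\<close> this is the trace down to the
  base field; the formula is used on the whole closure, so that additivity holds without side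
  conditions.\<close>

definition rel_trace :: "nat \<Rightarrow> 'a :: finite_field alg_closure \<Rightarrow> 'a alg_closure" where
  "rel_trace d x = (\<Sum>t<d. x ^ (CARD('a) ^ t))"

lemma rel_trace_add: "rel_trace d (x + y) = rel_trace d x + rel_trace d y"
  by (simp add: rel_trace_def alg_closure_frobenius_add sum.distrib)

lemma rel_trace_0 [simp]: "rel_trace d (0 :: 'a :: finite_field alg_closure) = 0"
  by (simp add: rel_trace_def power_0_left)

lemma rel_trace_sum: "rel_trace d (\<Sum>i\<in>A. f i) = (\<Sum>i\<in>A. rel_trace d (f i))"
  by (induction A rule: infinite_finite_induct) (auto simp: rel_trace_add)

lemma rel_trace_scale: "rel_trace d (to_ac a * x) = to_ac a * rel_trace d x"
proof -
  have "to_ac a ^ (CARD('a) ^ t) = to_ac a" for t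
    using to_ac_frob_fixed[of a t] by (simp add: frob_fixed_def)
  then show ?thesis
    by (simp add: rel_trace_def power_mult_distrib sum_distrib_left)
qed

text \<open>The q-th power permutes the summands cyclically because \<open>x ^ (q^d) = x\<close>. So
  the trace is fixed by Frobenius and lies in the base field.\<close>

lemma rel_trace_in_range:
  assumes "x \<in> frob_fixed d"
  shows "rel_trace d x \<in> range (to_ac :: 'a :: finite_field \<Rightarrow> _)"
proof -
  let ?q = "CARD('a)"
  have "rel_trace d x ^ ?q = (\<Sum>t<d. x ^ (?q ^ Suc t))"
    using alg_closure_frobenius_sum[of "\<lambda>t. x ^ (?q ^ t)" "{..<d}" 1]
    by (simp add: rel_trace_def mult.commute flip: power_mult)
  also have "\<dots> + x = rel_trace d x + x ^ (?q ^ d)"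
    using sum.lessThan_Suc_shift[of "\<lambda>t. x ^ (?q ^ t)" d]
    by (simp add: rel_trace_def add.commute)
  finally show ?thesis
    using assms by (simp add: range_to_ac frob_fixed_def)
qed

text \<open>The trace polynomial cannot vanish on all \<open>q^d\<close> elements. If the trace of
  \<open>x\<close> is nonzero and \<open>z \<noteq> 0\<close>, then \<open>b = x / z\<close>
  violates the assumption.\<close>

lemma rel_trace_nondegenerate:
  fixes z :: "'a :: finite_field alg_closure"
  assumes d: "d > 0" and z: "z \<in> frob_fixed d"
    and 0: "\<And>b. b \<in> frob_fixed d \<Longrightarrow> rel_trace d (b * z) = 0"
  shows "z = 0"
proof (rule ccontr)
  assume "z \<noteq> 0"
  have q: "CARD('a) > 1" by (rule card_finite_field_gt_1)
  have "CARD('a) ^ (d - 1) < CARD('a) ^ d" using d q by (intro power_strict_increasing) auto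
  then obtain x :: "'a alg_closure" where x: "x \<in> frob_fixed d" "rel_trace d x \<noteq> 0"
    using exists_nonzero_trace_polynomial[OF d q finite_frob_fixed[where ?'a = 'a, OF d]]
    by (auto simp: card_frob_fixed[OF d] rel_trace_def)
  have "rel_trace d (x / z * z) = 0" using x(1) z by (intro 0 frob_fixed_divide)
  with x(2) \<open>z \<noteq> 0\<close> show False by simp
qed

lemma rel_trace_diff: "rel_trace d (x - y) = rel_trace d x - rel_trace d y"
  using rel_trace_add[of d "x - y" y] by simp

text \<open>Frobenius has period two on \<open>frob_fixed 2\<close>, so only the parity of the
  exponent matters.\<close>

lemma frob_fixed_2_power_eq:
  assumes "\<gamma> \<in> frob_fixed 2" "even (s + t)"
  shows "\<gamma> ^ (CARD('a :: finite_field) ^ s) = (\<gamma> :: 'a alg_closure) ^ (CARD('a) ^ t)"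
proof -
  have "\<gamma> ^ (CARD('a) ^ s) = \<gamma> ^ (CARD('a) ^ (s mod 2))" for s
  proof -
    have "CARD('a) ^ s = CARD('a) ^ (2 * (s div 2)) * CARD('a) ^ (s mod 2)"
      by (simp flip: power_add)
    then have "\<gamma> ^ (CARD('a) ^ s) = (\<gamma> ^ (CARD('a) ^ (2 * (s div 2)))) ^ (CARD('a) ^ (s mod 2))"
      by (simp only: power_mult)
    also have "\<gamma> ^ (CARD('a) ^ (2 * (s div 2))) = \<gamma>"
      using assms(1) by (rule frob_fixed_dvd)
    finally show ?thesis .
  qed
  moreover have "s mod 2 = t mod 2" using assms(2) by presburger
  ultimately show ?thesis by metis
qed

text \<open>Exchanging \<open>s\<close> and \<open>t\<close> in the second product gives both the
  same monomials. For \<gamma> in \<open>frob_fixed 2\<close> the coefficient is 0 when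
  \<open>s + t\<close> is even, so only odd \<open>s + t\<close> has to be treated later.\<close>

lemma rel_trace_antisymmetric:
  fixes x y \<gamma> :: "'a :: finite_field alg_closure"
  shows "rel_trace d x * rel_trace d (\<gamma> * y) - rel_trace d y * rel_trace d (\<gamma> * x) =
    (\<Sum>s<d. \<Sum>t<d. (\<gamma> ^ (CARD('a) ^ t) - \<gamma> ^ (CARD('a) ^ s)) *
      (x ^ (CARD('a) ^ s) * y ^ (CARD('a) ^ t)))"
proof -
  let ?q = "CARD('a)"
  have 1: "rel_trace d x * rel_trace d (\<gamma> * y) =
      (\<Sum>s<d. \<Sum>t<d. \<gamma> ^ (?q ^ t) * (x ^ (?q ^ s) * y ^ (?q ^ t)))"
    unfolding rel_trace_def power_mult_distrib sum_product
    by (intro sum.cong refl) (simp add: ac_simps)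
  have "rel_trace d y * rel_trace d (\<gamma> * x) =
      (\<Sum>s<d. \<Sum>t<d. \<gamma> ^ (?q ^ t) * (x ^ (?q ^ t) * y ^ (?q ^ s)))"
    unfolding rel_trace_def power_mult_distrib sum_product
    by (intro sum.cong refl) (simp add: ac_simps)
  also have "\<dots> = (\<Sum>s<d. \<Sum>t<d. \<gamma> ^ (?q ^ s) * (x ^ (?q ^ s) * y ^ (?q ^ t)))"
    by (rule sum.swap)
  finally show ?thesis
    unfolding 1 by (simp add: left_diff_distrib sum_subtractf)
qed

section \<open>Symplectic spaces over a finite field\<close>

text \<open>Dimension is expressed through cardinality, dimension \<open>d\<close> meaning
  \<open>q^d\<close> elements, so that statements about dimension become counting arguments.\<close>

locale symplectic_space = vector_space scale
  for scale :: "'a :: finite_field \<Rightarrow> 'v :: ab_group_add \<Rightarrow> 'v" (infixr \<open>*s\<close> 75) +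
  fixes V :: "'v set" and N :: nat and form :: "'v \<Rightarrow> 'v \<Rightarrow> 'a"
  assumes subspace_V: "subspace V"
    and card_V: "card V = CARD('a) ^ N"
    and form_add_left: "form (x + y) z = form x z + form y z"
    and form_scale_left: "form (a *s x) z = a * form x z"
    and form_self: "form x x = 0"
    and form_skew: "form x y = - form y x"
    and form_nondegenerate: "x \<in> V \<Longrightarrow> (\<And>y. y \<in> V \<Longrightarrow> form x y = 0) \<Longrightarrow> x = 0"
begin

definition perp :: "'v set \<Rightarrow> 'v set" where
  "perp W = {v \<in> V. \<forall>w\<in>W. form v w = 0}"

lemma finite_V: "finite V"
  using card_V card_finite_field_gt_1[where ?'a = 'a]
  by (metis card.infinite not_one_less_zero power_eq_0_iff)

lemma form_zero_left [simp]: "form 0 x = 0"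
  using form_scale_left[of 0 0 x] by simp

lemma form_add_right: "form z (x + y) = form z x + form z y"
  by (metis form_skew form_add_left minus_add_distrib)

lemma form_scale_right: "form z (a *s x) = a * form z x"
  by (metis form_skew form_scale_left mult_minus_right)

lemma form_zero_right [simp]: "form x 0 = 0"
  using form_scale_right[of x 0 0] by simp

lemma form_diff_left: "form (x - y) z = form x z - form y z"
  using form_add_left[of "x - y" y z] by simp

lemma subspace_perp: "subspace (perp W)"
  using subspace_V by (auto simp: subspace_def perp_def form_add_left form_scale_left)

lemma perp_subset: "perp W \<subseteq> V"
  by (auto simp: perp_def)

lemma finite_perp: "finite (perp W)"
  using finite_V perp_subset by (rule rev_finite_subset)

lemma perp_antimono: "U \<subseteq> W \<Longrightarrow> perp W \<subseteq> perp U"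
  by (auto simp: perp_def)

lemma subset_perp_perp:
  assumes "W \<subseteq> V"
  shows "W \<subseteq> perp (perp W)"
proof
  fix w assume "w \<in> W"
  then show "w \<in> perp (perp W)"
    using assms form_skew[of w] by (auto simp: perp_def)
qed

lemma span_insert_eq:
  assumes "subspace W"
  shows "span (insert v W) = (\<lambda>(w, a). w + a *s v) ` (W \<times> UNIV)"
proof -
  have span_W: "span W = W" using assms by simp
  have "x \<in> (\<lambda>(w, a). w + a *s v) ` (W \<times> UNIV)" if "x - k *s v \<in> W" for x k
    using that by (intro image_eqI[of _ _ "(x - k *s v, k)"]) auto
  moreover have "\<exists>k. (w + a *s v) - k *s v \<in> W" if "w \<in> W" for w a
    using that by (intro exI[of _ a]) simp
  ultimately show ?thesis
    unfolding span_insert span_W by auto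
qed

lemma span_insert_subset: "subspace U \<Longrightarrow> v \<in> U \<Longrightarrow> W \<subseteq> U \<Longrightarrow> span (insert v W) \<subseteq> U"
  by (rule span_minimal) auto

lemma card_span_insert:
  assumes "subspace W" "v \<notin> W"
  shows "card (span (insert v W)) = card W * CARD('a)"
proof -
  have "inj_on (\<lambda>(w, a). w + a *s v) (W \<times> UNIV)"
  proof (rule inj_onI, clarify)
    fix w w' a a'
    assume w: "w \<in> W" "w' \<in> W" and eq: "w + a *s v = w' + a' *s v"
    then have *: "(a - a') *s v = w' - w"
      by (simp add: scale_left_diff_distrib algebra_simps)
    have "a = a'"
    proof (rule ccontr)
      assume "a \<noteq> a'"
      then have "v = inverse (a - a') *s (a - a') *s v" by simp
      also have "\<dots> \<in> W"
        unfolding * using assms(1) w by (intro subspace_scale subspace_diff)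
      finally show False using assms(2) by simp
    qed
    with eq show "w = w' \<and> a = a'" by simp
  qed
  then show ?thesis
    unfolding span_insert_eq[OF assms(1)] by (simp add: card_image card_cartesian_product)
qed

section \<open>Counting orthogonal complements\<close>

text \<open>Subtracting one element of a nonempty fibre of \<open>form _ v\<close> embeds that fibre
  into the kernel, and there are q fibres.\<close>

lemma card_le_card_kernel:
  assumes "subspace U" "finite U"
  shows "card U \<le> CARD('a) * card {u \<in> U. form u v = 0}"
proof -
  have "card U = card (\<Union>a. {u \<in> U. form u v = a})"
    by (rule arg_cong[where f = card]) auto
  also have "\<dots> \<le> (\<Sum>a\<in>UNIV. card {u \<in> U. form u v = a})"
    by (rule card_UN_le) simp
  also have "\<dots> \<le> (\<Sum>a\<in>(UNIV :: 'a set). card {u \<in> U. form u v = 0})"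
  proof (rule sum_mono)
    fix a
    show "card {u \<in> U. form u v = a} \<le> card {u \<in> U. form u v = 0}"
    proof (cases "{u \<in> U. form u v = a} = {}")
      case False
      then obtain u where u: "u \<in> U" "form u v = a" by blast
      have "(\<lambda>x. x - u) ` {u \<in> U. form u v = a} \<subseteq> {u \<in> U. form u v = 0}"
        using u assms(1) by (auto simp: form_diff_left intro: subspace_diff)
      then show ?thesis
        using assms(2) by (intro card_inj_on_le[of "\<lambda>x. x - u"]) (auto simp: inj_on_def)
    next
      case True
      then show ?thesis by (simp only: card.empty)
    qed
  qed
  finally show ?thesis by simp
qed

lemma perp_span_insert:
  assumes "subspace W"
  shows "perp (span (insert v W)) = {u \<in> perp W. form u v = 0}"
proof -
  have "v \<in> span (insert v W)" "W \<subseteq> span (insert v W)"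
    using span_superset[of "insert v W"] by auto
  moreover have "form u x = 0"
    if "u \<in> perp W" "form u v = 0" "x \<in> span (insert v W)" for u x
    using that unfolding span_insert_eq[OF assms]
    by (auto simp: perp_def form_add_right form_scale_right)
  ultimately show ?thesis by (auto simp: perp_def)
qed

text \<open>Adjoining one vector multiplies the size of the subspace by q and divides that of its
  complement by at most q.\<close>

lemma card_times_card_perp_mono:
  assumes "subspace W" "subspace W'" "W \<subseteq> W'" "W' \<subseteq> V"
  shows "card W * card (perp W) \<le> card W' * card (perp W')"
  using assms
proof (induction "card W' - card W" arbitrary: W rule: less_induct)
  case less
  have fin: "finite W'" using less.prems(4) finite_V by (rule finite_subset)
  show ?case
  proof (cases "W = W'")
    case False
    with less.prems obtain v where v: "v \<in> W'" "v \<notin> W" by blast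
    define U where "U = span (insert v W)"
    have U: "subspace U" "U \<subseteq> W'" "card U = card W * CARD('a)"
      using less.prems v by (auto simp: U_def span_insert_subset card_span_insert)
    have "0 < card W"
      using less.prems fin by (metis card_gt_0_iff empty_iff finite_subset subspace_0)
    then have "card W < card U"
      using U(3) card_finite_field_gt_1[where ?'a = 'a] by simp
    moreover have "card U \<le> card W'" using U(2) fin by (rule card_mono[rotated])
    ultimately have "card W' - card U < card W' - card W" by simp
    with U less have IH: "card U * card (perp U) \<le> card W' * card (perp W')" by blast
    have "card (perp W) \<le> CARD('a) * card (perp U)"
      unfolding U_def perp_span_insert[OF less.prems(1)]
      by (intro card_le_card_kernel subspace_perp finite_perp)
    then have "card W * card (perp W) \<le> card W * (CARD('a) * card (perp U))"
      by (rule mult_left_mono) simp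
    also have "\<dots> = card U * card (perp U)" by (simp add: U(3))
    finally show ?thesis using IH by (rule le_trans)
  qed simp
qed

lemma perp_zero: "perp {0} = V"
  by (auto simp: perp_def)

lemma perp_V: "perp V = {0}"
  using form_nondegenerate subspace_0[OF subspace_V] by (auto simp: perp_def)

text \<open>The product of sizes is monotone in the subspace, and it equals \<open>q^N\<close> at
  both extremes \<open>{0}\<close> and \<open>V\<close>.\<close>

lemma card_times_card_perp:
  assumes "subspace W" "W \<subseteq> V"
  shows "card W * card (perp W) = CARD('a) ^ N"
proof (rule antisym)
  show "card W * card (perp W) \<le> CARD('a) ^ N"
    using card_times_card_perp_mono[OF assms(1) subspace_V assms(2)]
    by (simp add: perp_V card_V)
  show "CARD('a) ^ N \<le> card W * card (perp W)"
    using card_times_card_perp_mono[OF subspace_single_0 assms(1)] assms subspace_0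
    by (simp add: perp_zero card_V)
qed

lemma card_perp:
  assumes "subspace W" "W \<subseteq> V" "card W = CARD('a) ^ d"
  shows "d \<le> N" "card (perp W) = CARD('a) ^ (N - d)"
proof -
  have eq: "CARD('a) ^ d * card (perp W) = CARD('a) ^ N"
    using card_times_card_perp[OF assms(1,2)] assms(3) by simp
  have "0 < card (perp W)"
    using finite_perp subspace_perp subspace_0 by (metis card_gt_0_iff empty_iff)
  with eq have "CARD('a) ^ d \<le> CARD('a) ^ N"
    by (metis dvd_imp_le dvd_triv_left zero_less_power zero_less_card_finite)
  then show "d \<le> N"
    using card_finite_field_gt_1[where ?'a = 'a] by (simp add: power_increasing_iff)
  then have "CARD('a) ^ d * card (perp W) = CARD('a) ^ d * CARD('a) ^ (N - d)"
    using eq by (simp flip: power_add)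
  then show "card (perp W) = CARD('a) ^ (N - d)" by simp
qed

lemma perp_perp:
  assumes "subspace W" "W \<subseteq> V"
  shows "perp (perp W) = W"
proof -
  have "card W * card (perp W) = card (perp (perp W)) * card (perp W)"
    using card_times_card_perp[OF assms] card_times_card_perp[OF subspace_perp perp_subset]
    by (simp add: mult.commute)
  moreover have "0 < card (perp W)"
    using finite_perp subspace_perp subspace_0 by (metis card_gt_0_iff empty_iff)
  ultimately have "card W = card (perp (perp W))" by simp
  then show ?thesis
    using subset_perp_perp[OF assms(2)] finite_perp by (metis card_subset_eq)
qed

lemma card_subspace_power:
  assumes "subspace W" "W \<subseteq> V"
  obtains d where "card W = CARD('a) ^ d"
proof -
  have "\<exists>d. card W = CARD('a) ^ d"
    if "subspace U" "U \<subseteq> W" "card U = CARD('a) ^ e" for U e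
    using that
  proof (induction "card W - card U" arbitrary: U e rule: less_induct)
    case less
    have fin: "finite W" using assms(2) finite_V by (rule finite_subset)
    show ?case
    proof (cases "U = W")
      case False
      with less.prems obtain v where v: "v \<in> W" "v \<notin> U" by blast
      define U' where "U' = span (insert v U)"
      have U': "subspace U'" "U' \<subseteq> W" "card U' = CARD('a) ^ Suc e"
        using less.prems v assms by (auto simp: U'_def span_insert_subset card_span_insert)
      have "card U < card U'"
        using U'(3) less.prems(3) card_finite_field_gt_1[where ?'a = 'a] by simp
      moreover have "card U' \<le> card W" using U'(2) fin by (rule card_mono[rotated])
      ultimately have "card W - card U' < card W - card U" by simp
      then show ?thesis using less.hyps U' by blast
    qed (use less.prems in blast)
  qed
  from this[of "{0}" 0] show ?thesis
    using assms subspace_0 that by auto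
qed

section \<open>Extensions with prescribed radical and size\<close>

text \<open>While an isotropic \<open>U\<close> has dimension \<open>t < N - t\<close>, its
  complement is larger than \<open>U\<close>. Any \<open>v\<close> in the difference can be
  adjoined, because \<open>form v v = 0\<close>.\<close>

lemma isotropic_extension:
  assumes "subspace D" "D \<subseteq> perp D" "card D \<le> CARD('a) ^ s" "2 * s \<le> N"
  obtains D' where "subspace D'" "D \<subseteq> D'" "D' \<subseteq> perp D'" "card D' = CARD('a) ^ s"
proof -
  have "D \<subseteq> V" using assms(2) perp_subset by blast
  with assms(1) obtain d where d: "card D = CARD('a) ^ d" by (rule card_subspace_power)
  then have "d \<le> s"
    using assms(3) card_finite_field_gt_1[where ?'a = 'a] by (simp add: power_increasing_iff)
  then have "\<exists>D'. subspace D' \<and> D \<subseteq> D' \<and> D' \<subseteq> perp D' \<and> card D' = CARD('a) ^ s"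
    using assms(4)
  proof (induction s rule: dec_induct)
    case base
    then show ?case using assms d by blast
  next
    case (step t)
    then obtain U where U: "subspace U" "D \<subseteq> U" "U \<subseteq> perp U" "card U = CARD('a) ^ t"
      by auto
    have "U \<subseteq> V" using U(3) perp_subset by blast
    then have "card (perp U) = CARD('a) ^ (N - t)" using U by (intro card_perp)
    moreover have "t < N - t" using step.prems by simp
    ultimately have "U \<noteq> perp U"
      using U(4) card_finite_field_gt_1[where ?'a = 'a] power_strict_increasing
      by (metis nat_less_le)
    then obtain v where v: "v \<in> perp U" "v \<notin> U" using U(3) by blast
    define U' where "U' = span (insert v U)"
    have perp_U': "perp U' = {u \<in> perp U. form u v = 0}"
      unfolding U'_def using U(1) by (rule perp_span_insert)
    have "form u v = 0" if "u \<in> U" for u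
      using v(1) that form_skew[of u v] by (simp add: perp_def)
    then have "v \<in> perp U'" "U \<subseteq> perp U'"
      using v(1) U(3) form_self[of v] by (auto simp: perp_U')
    then have "U' \<subseteq> perp U'"
      unfolding U'_def by (intro span_insert_subset subspace_perp)
    moreover have "U \<subseteq> U'" unfolding U'_def using span_superset by blast
    moreover have "card U' = CARD('a) ^ Suc t"
      unfolding U'_def using U v by (simp add: card_span_insert)
    ultimately show ?case
      using U(2) by (intro exI[of _ U']) (auto simp: U'_def)
  qed
  then show ?thesis using that by blast
qed

text \<open>Each induction step adjoins to \<open>C\<close> a pair \<open>e\<close>,
  \<open>f\<close> from \<open>perp C\<close> with \<open>form e f \<noteq> 0\<close>. The dimension
  grows by two and the radical stays \<open>D\<close>.\<close>

lemma gauge_extension: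
  assumes "subspace D" "D \<subseteq> perp D" "card D = CARD('a) ^ s" "2 * s + 2 * r \<le> N"
  obtains C where "subspace C" "C \<subseteq> V" "C \<inter> perp C = D" "card C = CARD('a) ^ (s + 2 * r)"
proof -
  have "\<exists>C. subspace C \<and> C \<subseteq> V \<and> C \<inter> perp C = D \<and> card C = CARD('a) ^ (s + 2 * r)"
    using assms(4)
  proof (induction r)
    case 0
    then show ?case using assms perp_subset by (intro exI[of _ D]) auto
  next
    case (Suc r)
    then obtain C where C: "subspace C" "C \<subseteq> V" "C \<inter> perp C = D"
        "card C = CARD('a) ^ (s + 2 * r)" by auto
    have "card (perp C) = CARD('a) ^ (N - (s + 2 * r))" using C by (intro card_perp)
    moreover have "s < N - (s + 2 * r)" using Suc.prems by simp
    ultimately have "perp C \<noteq> D"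
      using assms(3) card_finite_field_gt_1[where ?'a = 'a] power_strict_increasing
      by (metis nat_less_le)
    then obtain e where e: "e \<in> perp C" "e \<notin> D" using C(3) by blast
    have "e \<in> V" using e(1) perp_subset by blast
    \<comment> \<open>Here \<open>perp (perp C)\<close> is \<open>C\<close>, which meets
      \<open>perp C\<close> only in \<open>D\<close>. So \<open>e\<close> fails to be orthogonal to
      some \<open>f\<close> in \<open>perp C\<close>, its partner.\<close>
    have "e \<notin> perp (perp C)" using perp_perp[OF C(1,2)] e C(3) by blast
    with \<open>e \<in> V\<close> obtain f where f: "f \<in> perp C" "form e f \<noteq> 0" by (auto simp: perp_def)
    then have f': "form f e \<noteq> 0" using form_skew[of e f] by simp
    have "f \<in> V" using f(1) perp_subset by blast
    define C1 where "C1 = span (insert e C)"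
    define C2 where "C2 = span (insert f C1)"
    have "e \<notin> C" using e C(3) by blast
    then have card_C1: "card C1 = CARD('a) ^ Suc (s + 2 * r)"
      unfolding C1_def using C by (simp add: card_span_insert)
    have "e \<in> perp C1"
      unfolding C1_def using e C(1) by (simp add: perp_span_insert form_self)
    then have "f \<notin> C1" using f(2) by (auto simp: perp_def)
    then have card_C2: "card C2 = CARD('a) ^ (s + 2 * Suc r)"
      unfolding C2_def using card_C1 by (simp add: card_span_insert C1_def)
    have perp_C2: "perp C2 = {u \<in> perp C. form u e = 0 \<and> form u f = 0}"
      unfolding C2_def using C(1) by (auto simp: C1_def perp_span_insert)
    have C_C2: "C \<subseteq> C2"
      unfolding C2_def C1_def using span_superset by blast
    have "C1 \<subseteq> V"
      unfolding C1_def using C(2) \<open>e \<in> V\<close> by (intro span_insert_subset subspace_V)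
    then have "C2 \<subseteq> V"
      unfolding C2_def using \<open>f \<in> V\<close> by (intro span_insert_subset subspace_V)
    moreover have "C2 \<inter> perp C2 = D"
    proof (intro equalityI subsetI)
      fix x assume "x \<in> C2 \<inter> perp C2"
      then have x: "x \<in> C2" "x \<in> perp C" "form x e = 0" "form x f = 0"
        by (auto simp: perp_C2)
      from x(1) obtain y b where y: "y \<in> C1" "x = y + b *s f"
        unfolding C2_def by (subst (asm) span_insert_eq) (auto simp: C1_def)
      from y(1) obtain c a where c: "c \<in> C" "y = c + a *s e"
        unfolding C1_def span_insert_eq[OF C(1)] by auto
      have ce: "form c e = 0" "form c f = 0"
        using c(1) e(1) f(1) form_skew[of c] by (auto simp: perp_def)
      \<comment> \<open>Pairing \<open>x = c + a *s e + b *s f\<close> with \<open>e\<close>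
        isolates \<open>b\<close>, and pairing with \<open>f\<close> then isolates \<open>a\<close>;
        both are 0.\<close>
      have "form x e = b * form f e"
        by (simp add: y c form_add_left form_scale_left ce form_self)
      with x f' have "b = 0" by simp
      then have "form x f = a * form e f"
        by (simp add: y c form_add_left form_scale_left ce form_self)
      with x f have "a = 0" by simp
      with \<open>b = 0\<close> have "x = c" by (simp add: y c)
      with c(1) x(2) C(3) show "x \<in> D" by blast
    next
      fix x assume "x \<in> D"
      then have "x \<in> C" "x \<in> perp C" using C(3) by auto
      moreover have "form x e = 0" "form x f = 0"
        using \<open>x \<in> C\<close> e(1) f(1) form_skew[of x] by (auto simp: perp_def)
      ultimately show "x \<in> C2 \<inter> perp C2" using C_C2 by (auto simp: perp_C2)
    qed
    ultimately show ?case
      using card_C2 by (intro exI[of _ C2]) (auto simp: C2_def)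
  qed
  then show ?thesis using that by blast
qed

end

section \<open>The symplectic space of coordinate functions\<close>

definition fscale :: "'a :: times \<Rightarrow> (nat \<Rightarrow> 'a) \<Rightarrow> nat \<Rightarrow> 'a" where
  "fscale a f = (\<lambda>i. a * f i)"

text \<open>Vectors of dimension \<open>N\<close> are modelled as functions that vanish from index
  \<open>N\<close> on: for every \<open>N\<close> these lie in the same additive group, as
  \<open>vector_space\<close> requires.\<close>

definition coord_space :: "nat \<Rightarrow> (nat \<Rightarrow> 'a :: zero) set" where
  "coord_space N = {f. \<forall>i\<ge>N. f i = 0}"

text \<open>This is the symplectic product before the trace is applied, with the sign convention of
  \<open>trace_symplectic\<close>.\<close>

definition sform :: "nat \<Rightarrow> (nat \<Rightarrow> 'a :: ring) \<Rightarrow> (nat \<Rightarrow> 'a) \<Rightarrow> 'a" where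
  "sform n f g = (\<Sum>i<n. g i * f (n + i) - f i * g (n + i))"

lemma card_coord_space: "card (coord_space N :: (nat \<Rightarrow> 'a :: {finite, zero}) set) = CARD('a) ^ N"
proof -
  have "bij_betw (\<lambda>f. restrict f {..<N}) (coord_space N :: (nat \<Rightarrow> 'a) set) ({..<N} \<rightarrow>\<^sub>E UNIV)"
    by (rule bij_betw_byWitness[where f' = "\<lambda>g i. if i < N then g i else 0"])
      (auto simp: coord_space_def fun_eq_iff PiE_def extensional_def)
  then show ?thesis by (simp add: bij_betw_same_card card_funcsetE)
qed

lemma sform_unit_left:
  fixes f :: "nat \<Rightarrow> 'a :: ring_1"
  assumes "j < n"
  shows "sform n f (\<lambda>k. if k = j then 1 else 0) = f (n + j)"
proof -
  have "sform n f (\<lambda>k. if k = j then 1 else 0) = (\<Sum>i<n. if i = j then f (n + i) else 0)"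
    unfolding sform_def using assms by (intro sum.cong) auto
  then show ?thesis using assms by simp
qed

lemma sform_unit_right:
  fixes f :: "nat \<Rightarrow> 'a :: ring_1"
  assumes "j < n"
  shows "sform n f (\<lambda>k. if k = n + j then 1 else 0) = - f j"
proof -
  have "sform n f (\<lambda>k. if k = n + j then 1 else 0) = (\<Sum>i<n. if i = j then - f i else 0)"
    unfolding sform_def using assms by (intro sum.cong) auto
  then show ?thesis using assms by simp
qed

lemma vector_space_fscale: "vector_space (fscale :: 'a :: field \<Rightarrow> _)"
  by standard (auto simp: fscale_def fun_eq_iff algebra_simps)

interpretation coord: symplectic_space fscale "coord_space (2 * n)" "2 * n" "sform n"
  for n :: nat
proof (intro symplectic_space.intro vector_space_fscale symplectic_space_axioms.intro)
  fix f g h :: "nat \<Rightarrow> 'a :: finite_field" and a b :: 'a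
  show "sform n (f + g) h = sform n f h + sform n g h"
    unfolding sform_def sum.distrib[symmetric] by (intro sum.cong) (auto simp: algebra_simps)
  show "sform n (fscale a f) h = a * sform n f h"
    unfolding sform_def fscale_def sum_distrib_left by (intro sum.cong) (auto simp: algebra_simps)
  show "sform n f f = 0" by (simp add: sform_def mult.commute)
  show "sform n f g = - sform n g f"
    by (simp add: sform_def mult.commute sum_subtractf)
next
  interpret vector_space "fscale :: 'a :: finite_field \<Rightarrow> _" by (rule vector_space_fscale)
  show "module.subspace fscale (coord_space (2 * n) :: (nat \<Rightarrow> 'a :: finite_field) set)"
    by (auto simp: subspace_def coord_space_def fscale_def)
next
  fix f :: "nat \<Rightarrow> 'a :: finite_field"
  assume f: "f \<in> coord_space (2 * n)" and 0: "\<And>g. g \<in> coord_space (2 * n) \<Longrightarrow> sform n f g = 0"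
  \<comment> \<open>Pairing with unit vectors reads off the coordinates up to sign.\<close>
  have "f i = 0 \<and> f (n + i) = 0" if "i < n" for i
    using 0[of "\<lambda>k. if k = i then 1 else 0"] 0[of "\<lambda>k. if k = n + i then 1 else 0"] that
    by (simp add: sform_unit_left sform_unit_right coord_space_def)
  moreover have "i < n \<or> i = n + (i - n) \<and> i - n < n \<or> 2 * n \<le> i" for i by linarith
  ultimately have "f i = 0" for i
    using f by (metis (mono_tags, lifting) coord_space_def mem_Collect_eq)
  then show "f = 0" by (simp add: fun_eq_iff)
qed (rule card_coord_space)

section \<open>Translation between functions and vectors\<close>

lemma trace_symplectic_vec:
  "trace_symplectic n (vec (2 * n) f) (vec (2 * n) g) = field_tr (sform n f g)"
proof -
  have "vec_first (vec (2 * n) h) n = vec n h" "vec_last (vec (2 * n) h) n = vec n (\<lambda>i. h (n + i))"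
    for h :: "nat \<Rightarrow> 'a"
    by (auto simp: vec_first_def vec_last_def mult_2)
  then show ?thesis
    by (simp add: trace_symplectic_def sform_def scalar_prod_def sum_subtractf atLeast0LessThan)
qed

lemma swt_vec: "swt n (vec (2 * n) f) = card {i. i < n \<and> (f i, f (n + i)) \<noteq> (0, 0)}"
  unfolding swt_def by (rule arg_cong[where f = card]) (auto simp: mult_2)

lemma inj_on_vec: "inj_on (vec N) (coord_space N)"
proof (rule inj_onI)
  fix f g :: "nat \<Rightarrow> 'a" assume "f \<in> coord_space N" "g \<in> coord_space N" "vec N f = vec N g"
  then have "f i = g i" for i
    by (cases "i < N") (auto simp: coord_space_def dest: arg_cong[where f = "\<lambda>v. vec_index v i"])
  then show "f = g" by (simp add: fun_eq_iff)
qed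

lemma vec_image_coord_space: "vec N ` coord_space N = carrier_vec N"
proof (intro equalityI subsetI)
  fix v :: "'a vec" assume v: "v \<in> carrier_vec N"
  show "v \<in> vec N ` coord_space N"
    using v by (intro image_eqI[of _ _ "\<lambda>i. if i < N then vec_index v i else 0"])
      (auto simp: coord_space_def intro!: eq_vecI)
qed auto

lemma additive_subgroup_vec_image:
  assumes "coord.subspace C"
  shows "additive_subgroup (vec N ` C) (module_vec TYPE('a :: finite_field) N)"
proof (intro additive_subgroupI subgroup.intro)
  let ?G = "add_monoid (module_vec TYPE('a) N)"
  interpret G: group ?G
    by (rule groupI) (auto simp: module_vec_simps, metis add_inv_exists_vec)
  show "vec N ` C \<subseteq> carrier ?G" by (auto simp: module_vec_simps)
  show "\<one>\<^bsub>?G\<^esub> \<in> vec N ` C"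
    using coord.subspace_0[OF assms]
    by (intro image_eqI[of _ _ 0]) (auto simp: module_vec_simps)
  fix x y assume x: "x \<in> vec N ` C" and y: "y \<in> vec N ` C"
  from x obtain f where f: "f \<in> C" "x = vec N f" by blast
  from y obtain g where g: "g \<in> C" "y = vec N g" by blast
  show "x \<otimes>\<^bsub>?G\<^esub> y \<in> vec N ` C"
    using coord.subspace_add[OF assms f(1) g(1)]
    by (intro image_eqI[of _ _ "f + g"]) (auto simp: module_vec_simps f g)
  have "inv\<^bsub>?G\<^esub> x = vec N (- f)"
    by (rule G.inv_equality) (auto simp: module_vec_simps f)
  then show "inv\<^bsub>?G\<^esub> x \<in> vec N ` C"
    using coord.subspace_neg[OF assms f(1)] by blast
qed

lemma field_tr_0: "field_tr 0 = 0"
  by (simp add: field_tr_def power_0_left)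

text \<open>For a linear code the trace does not enlarge the dual: a nonzero value of the form could
  be rescaled, inside the code, to an element \<open>x\<close> of nonzero trace.\<close>

lemma symplectic_dual_vec_image:
  fixes C :: "(nat \<Rightarrow> 'a :: finite_field) set"
  assumes "coord.subspace C"
  shows "symplectic_dual n (vec (2 * n) ` C) = vec (2 * n) ` coord.perp n C"
proof (intro equalityI subsetI)
  fix v assume v: "v \<in> symplectic_dual n (vec (2 * n) ` C)"
  then have "v \<in> vec (2 * n) ` coord_space (2 * n)"
    unfolding vec_image_coord_space by (simp add: symplectic_dual_def)
  then obtain f where f: "f \<in> coord_space (2 * n)" "v = vec (2 * n) f" by blast
  have tr: "field_tr (sform n f g) = 0" if "g \<in> C" for g
    using v that f(2) by (auto simp: symplectic_dual_def trace_symplectic_vec)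
  obtain x :: 'a where x: "field_tr x \<noteq> 0" using field_tr_not_zero by blast
  have "sform n f g = 0" if "g \<in> C" for g
  proof (rule ccontr)
    assume nz: "sform n f g \<noteq> 0"
    have "fscale (x / sform n f g) g \<in> C" using assms that by (rule coord.subspace_scale)
    from tr[OF this] nz x show False by (simp add: coord.form_scale_right)
  qed
  with f show "v \<in> vec (2 * n) ` coord.perp n C" by (auto simp: coord.perp_def)
next
  fix v assume "v \<in> vec (2 * n) ` coord.perp n C"
  then show "v \<in> symplectic_dual n (vec (2 * n) ` C)"
    by (auto simp: symplectic_dual_def coord.perp_def trace_symplectic_vec field_tr_0)
qed

section \<open>Trace codes dual to BCH codes\<close>

text \<open>The left side is at most \<open>(\<delta> - 1) * (q^e + 1)\<close>. For odd
  \<open>m\<close> this is at most \<open>(q^m - 2) * (q^m + 1)\<close>. For even \<open>m\<close>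
  oddness of \<open>e\<close> forces \<open>e \<le> m - 1\<close>, and the bound becomes
  \<open>(q^(m+1) - q^2) * (q^(m-1) + 1) = q^(2*m) - q^2\<close>. This accounts for the parity terms
  in the range of \<delta>.\<close>

lemma bch_exponent_bound:
  fixes q m \<delta> i j e :: nat
  assumes q: "q > 1" and m: "m > 0"
    and \<delta>: "int \<delta> \<le> int q ^ (m + of_bool (even m)) - 1 - (int q ^ 2 - 2) * of_bool (even m)"
    and ij: "i < \<delta>" "j < \<delta>" and e: "odd e" "e \<le> m"
  shows "i * q ^ e + j < q ^ (2 * m) - 1"
proof -
  have "i * q ^ e + j \<le> (\<delta> - 1) * (q ^ e + 1)"
  proof -
    have "i * q ^ e + j \<le> (\<delta> - 1) * q ^ e + (\<delta> - 1)"
      using ij by (intro add_mono mult_right_mono) auto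
    then show ?thesis by (simp only: distrib_left mult_1_right)
  qed
  also have "(\<delta> - 1) * (q ^ e + 1) < q ^ (2 * m) - 1"
  proof (cases "even m")
    case False
    then have "\<delta> < q ^ m" using \<delta> by simp
    then have "(\<delta> - 1) + 2 \<le> q ^ m" using ij by linarith
    then obtain k where k: "q ^ m = (\<delta> - 1) + 2 + k" by (metis le_add_diff_inverse)
    have "q ^ e \<le> q ^ m" using e q by (intro power_increasing) auto
    then have "(\<delta> - 1) * (q ^ e + 1) \<le> (\<delta> - 1) * (q ^ m + 1)"
      by (intro mult_left_mono add_right_mono) auto
    moreover have "(\<delta> - 1) * (q ^ m + 1) + 1 < q ^ m * q ^ m"
      unfolding k by (simp add: algebra_simps)
    moreover have "q ^ m * q ^ m = q ^ (2 * m)" by (simp flip: power_add add: mult_2)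
    ultimately show ?thesis by linarith
  next
    case True
    then have em: "e \<le> m - 1" using e by (metis Suc_diff_1 le_antisym m not_less_eq_eq)
    have "int (\<delta> - 1) + int q ^ 2 \<le> int q ^ (m + 1)" using \<delta> True ij by simp
    then have "int ((\<delta> - 1) + q ^ 2) \<le> int (q ^ (m + 1))" by simp
    then have b: "(\<delta> - 1) + q ^ 2 \<le> q ^ (m + 1)" by (simp only: of_nat_le_iff)
    have "q ^ e \<le> q ^ (m - 1)" using em q by (intro power_increasing) auto
    then have 1: "(\<delta> - 1) * (q ^ e + 1) \<le> (\<delta> - 1) * (q ^ (m - 1) + 1)" by simp
    have "((\<delta> - 1) + q ^ 2) * (q ^ (m - 1) + 1) \<le> q ^ (m + 1) * (q ^ (m - 1) + 1)"
      using b by (rule mult_right_mono) simp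
    also have "\<dots> = q ^ (2 * m) + q ^ (m + 1)"
    proof -
      have "(m + 1) + (m - 1) = 2 * m" using m by simp
      then have "q ^ (m + 1) * q ^ (m - 1) = q ^ (2 * m)"
        by (simp only: flip: power_add)
      then show ?thesis by (simp add: algebra_simps)
    qed
    finally have "(\<delta> - 1) * (q ^ (m - 1) + 1) + q ^ 2 * q ^ (m - 1) + q ^ 2 \<le> q ^ (2 * m) + q ^ (m + 1)"
      by (simp add: algebra_simps)
    moreover have "q ^ 2 * q ^ (m - 1) = q ^ (m + 1)"
      using m by (simp flip: power_add)
    moreover have "q ^ 2 > 1" using q by (intro one_less_power) auto
    ultimately show ?thesis using 1 by linarith
  qed
  finally show ?thesis .
qed

text \<open>The modulus is coprime to \<open>q\<close>, so the smaller of the two powers of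
  \<open>q\<close> cancels, leaving \<open>i * q^e + j\<close> with odd \<open>e\<close>. If
  \<open>e > m\<close>, multiplying by \<open>q^(2*m-e)\<close> and using that
  \<open>q^(2*m)\<close> is 1 modulo \<open>?n\<close> swaps \<open>i\<close> and \<open>j\<close>
  and replaces \<open>e\<close> by \<open>2 * m - e\<close>. The remaining number is positive and
  below the modulus.\<close>

lemma bch_exponent_not_dvd:
  fixes q m \<delta> i j s t :: nat
  assumes q: "q > 1" and m: "m > 0"
    and \<delta>: "int \<delta> \<le> int q ^ (m + of_bool (even m)) - 1 - (int q ^ 2 - 2) * of_bool (even m)"
    and ij: "0 < i" "i < \<delta>" "0 < j" "j < \<delta>" and st: "s < 2 * m" "t < 2 * m" "odd (s + t)"
  shows "\<not> (q ^ (2 * m) - 1) dvd (i * q ^ s + j * q ^ t)"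
proof -
  let ?n = "q ^ (2 * m) - 1"
  have small: "\<not> ?n dvd (i * q ^ e + j)"
    if "odd e" "e \<le> m" "0 < i" "i < \<delta>" "0 < j" "j < \<delta>" for e i j
    using bch_exponent_bound[OF q m \<delta>, of i j e] that nat_dvd_not_less[of "i * q ^ e + j" ?n] by simp
  have reduced: "\<not> ?n dvd (i * q ^ e + j)"
    if e: "odd e" "e < 2 * m" and ij: "0 < i" "i < \<delta>" "0 < j" "j < \<delta>" for e i j
  proof (cases "e \<le> m")
    case True
    with small e ij show ?thesis by blast
  next
    case False
    show ?thesis
    proof
      assume "?n dvd (i * q ^ e + j)"
      then have "?n dvd (i * q ^ e + j) * q ^ (2 * m - e)" by simp
      also have "(i * q ^ e + j) * q ^ (2 * m - e) = i * q ^ (2 * m) + j * q ^ (2 * m - e)"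
        using e by (simp add: add_mult_distrib mult.assoc flip: power_add)
      also have "q ^ (2 * m) = ?n + 1" using q by simp
      finally have "?n dvd i * ?n + (j * q ^ (2 * m - e) + i)"
        by (simp add: algebra_simps)
      then have "?n dvd (j * q ^ (2 * m - e) + i)"
        by (metis dvd_add_times_triv_left_iff)
      moreover have "odd (2 * m - e)" "2 * m - e \<le> m" using e False by auto
      ultimately show False using small ij by blast
    qed
  qed
  have coprime: "coprime ?n (q ^ t)" for t
  proof -
    have "coprime ?n (q ^ (2 * m))"
      using q coprime_Suc_left_nat[of ?n] by (metis Suc_diff_1 coprime_Suc_right_nat zero_less_power gr_implies_not0 gr_zeroI)
    then show ?thesis using m by simp
  qed
  have ordered: "\<not> ?n dvd (i * q ^ s + j * q ^ t)"
    if st: "s < 2 * m" "t \<le> s" "odd (s + t)" and ij: "0 < i" "i < \<delta>" "0 < j" "j < \<delta>" for s t i j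
  proof
    assume "?n dvd (i * q ^ s + j * q ^ t)"
    also have "i * q ^ s + j * q ^ t = (i * q ^ (s - t) + j) * q ^ t"
      using st by (simp add: add_mult_distrib mult.assoc flip: power_add)
    finally have "?n dvd (i * q ^ (s - t) + j)"
      using coprime by (simp add: coprime_dvd_mult_left_iff)
    moreover have "odd (s - t)" "s - t < 2 * m" using st by auto
    ultimately show False using reduced ij by blast
  qed
  show ?thesis
  proof (cases "t \<le> s")
    case True
    with ordered ij st show ?thesis by blast
  next
    case False
    with ordered[of t s j i] ij st show ?thesis by (simp add: add.commute)
  qed
qed

text \<open>Removing the \<open>?b div Q\<close> multiples of \<open>Q\<close> from
  \<open>?b\<close> numbers leaves \<open>?b - ?b div Q\<close>, which the ceiling bounds. With
  \<open>Q = q^2\<close> this is the source of the ceiling in the code parameters.\<close>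

lemma card_not_multiples_le:
  assumes "Q > 0" "\<delta> > 0"
  shows "int (card {j\<in>{1..<\<delta>}. \<not> Q dvd j}) \<le> \<lceil>(real \<delta> - 1) * (1 - 1 / real Q)\<rceil>"
proof -
  let ?b = "\<delta> - 1"
  have "(\<lambda>k. Q * k) ` {1..?b div Q} \<subseteq> {1..<\<delta>}"
    using assms by (auto simp: Suc_le_eq less_eq_div_iff_mult_less_eq mult.commute)
  then have "card ({1..<\<delta>} - (\<lambda>k. Q * k) ` {1..?b div Q}) = ?b - card ((\<lambda>k. Q * k) ` {1..?b div Q})"
    by (subst card_Diff_subset) auto
  also have "card ((\<lambda>k. Q * k) ` {1..?b div Q}) = ?b div Q"
    using assms by (subst card_image) (auto simp: inj_on_def)
  finally have card: "card ({1..<\<delta>} - (\<lambda>k. Q * k) ` {1..?b div Q}) = ?b - ?b div Q" .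
  have "card {j\<in>{1..<\<delta>}. \<not> Q dvd j} \<le> ?b - ?b div Q"
    unfolding card[symmetric] by (intro card_mono) auto
  then have "int (card {j\<in>{1..<\<delta>}. \<not> Q dvd j}) \<le> int ?b - int (?b div Q)"
    by (simp flip: of_nat_diff)
  also have "\<dots> \<le> \<lceil>(real \<delta> - 1) * (1 - 1 / real Q)\<rceil>"
  proof -
    have "?b < Q * (?b div Q + 1)"
      using assms dividend_less_times_div[of Q ?b] by simp
    then have "real ?b < real Q * (real (?b div Q) + 1)"
      by (metis of_nat_1 of_nat_add of_nat_less_iff of_nat_mult)
    then have "real ?b / real Q < real (?b div Q) + 1"
      using assms by (simp add: pos_divide_less_eq mult.commute)
    moreover have "real ?b = real \<delta> - 1" using assms by simp
    ultimately show ?thesis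
      by (simp add: le_ceiling_iff right_diff_distrib)
  qed
  finally show ?thesis .
qed

section \<open>The trace code and its dual distance\<close>

text \<open>The map \<alpha> enumerates the nonzero elements of \<open>L\<close>. The condition on
  \<gamma> makes 1 and \<gamma> linearly independent over the base field, so a pair of coordinates
  can be merged into one element of \<open>frob_fixed 2\<close>.\<close>

locale bch =
  fixes m n \<delta> :: nat and \<gamma> :: "'a :: finite_field alg_closure" and \<alpha> :: "nat \<Rightarrow> 'a alg_closure"
  assumes m_pos: "m > 0"
    and n_def: "n = CARD('a) ^ (2 * m) - 1"
    and \<delta>_max: "int \<delta> \<le> int CARD('a) ^ (m + of_bool (even m)) - 1 -
      (int CARD('a) ^ 2 - 2) * of_bool (even m)"
    and \<gamma>: "\<gamma> \<in> frob_fixed 2" "\<gamma> \<notin> frob_fixed 1"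
    and \<alpha>: "bij_betw \<alpha> {..<n} {x. x ^ n = 1}"
begin

abbreviation L :: "'a alg_closure set" where "L \<equiv> frob_fixed (2 * m)"
abbreviation Tr :: "'a alg_closure \<Rightarrow> 'a alg_closure" where "Tr \<equiv> rel_trace (2 * m)"

text \<open>Multiples of \<open>q^2\<close> are left out because, for words over
  \<open>frob_fixed 2\<close>, the parity check at \<open>k * q^2\<close> is the
  \<open>q^2\<close>-th power of the one at \<open>k\<close>.\<close>

definition exponents :: "nat set" where
  "exponents = {j \<in> {1..<\<delta>}. \<not> CARD('a) ^ 2 dvd j}"

definition poly_value :: "(nat \<Rightarrow> 'a alg_closure) \<Rightarrow> nat \<Rightarrow> 'a alg_closure" where
  "poly_value a i = (\<Sum>j\<in>exponents. a j * \<alpha> i ^ j)"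

definition codeword :: "(nat \<Rightarrow> 'a alg_closure) \<Rightarrow> nat \<Rightarrow> 'a" where
  "codeword a i = of_ac (if i < n then Tr (poly_value a i)
     else if i < 2 * n then Tr (\<gamma> * poly_value a (i - n)) else 0)"

definition trace_code :: "(nat \<Rightarrow> 'a) set" where
  "trace_code = codeword ` (UNIV \<rightarrow> L)"

lemma q_gt_1: "CARD('a) > 1"
  by (rule card_finite_field_gt_1)

lemma n_pos: "n > 0"
  using one_less_power[OF q_gt_1, of "2 * m"] m_pos by (simp add: n_def)

lemma \<alpha>_power_n: "i < n \<Longrightarrow> \<alpha> i ^ n = 1"
  using \<alpha> by (auto simp: bij_betw_def)

lemma \<alpha>_nonzero: "i < n \<Longrightarrow> \<alpha> i \<noteq> 0"
  using \<alpha>_power_n n_pos by (fastforce simp: power_0_left)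

lemma \<alpha>_in_L: "i < n \<Longrightarrow> \<alpha> i \<in> L"
  using \<alpha>_power_n by (simp add: frob_fixed_eq n_def)

lemma \<gamma>_in_L: "\<gamma> \<in> L"
  using \<gamma>(1) frob_fixed_mono[of 2 "2 * m"] by auto

lemma finite_exponents: "finite exponents"
  by (simp add: exponents_def)

lemma poly_value_in_L: "a \<in> UNIV \<rightarrow> L \<Longrightarrow> i < n \<Longrightarrow> poly_value a i \<in> L"
  unfolding poly_value_def
  by (intro frob_fixed_sum frob_fixed_mult frob_fixed_power \<alpha>_in_L) auto

text \<open>Traces from \<open>L\<close> lie in the base field, so \<open>of_ac\<close> loses
  nothing. Identities between codewords are then checked in the closure, where \<open>to_ac\<close>
  is injective.\<close>

lemma to_ac_codeword:
  assumes "a \<in> UNIV \<rightarrow> L"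
  shows "to_ac (codeword a i) = (if i < n then Tr (poly_value a i)
     else if i < 2 * n then Tr (\<gamma> * poly_value a (i - n)) else 0)"
  unfolding codeword_def using assms poly_value_in_L
  by (intro to_ac_of_ac) (auto intro!: rel_trace_in_range frob_fixed_mult \<gamma>_in_L intro: image_eqI[of _ _ 0])

lemma codeword_add:
  assumes "a \<in> UNIV \<rightarrow> L" "b \<in> UNIV \<rightarrow> L"
  shows "codeword (\<lambda>j. a j + b j) = codeword a + codeword b"
proof
  fix i
  have "(\<lambda>j. a j + b j) \<in> UNIV \<rightarrow> L" using assms by (auto intro: frob_fixed_add)
  moreover have "poly_value (\<lambda>j. a j + b j) i = poly_value a i + poly_value b i" for i
    by (simp add: poly_value_def algebra_simps sum.distrib)
  ultimately have "to_ac (codeword (\<lambda>j. a j + b j) i) = to_ac ((codeword a + codeword b) i)"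
    using assms by (simp add: to_ac_codeword rel_trace_add distrib_left)
  then show "codeword (\<lambda>j. a j + b j) i = (codeword a + codeword b) i" by (simp only: to_ac_eq_iff)
qed

lemma codeword_scale:
  assumes "a \<in> UNIV \<rightarrow> L"
  shows "codeword (\<lambda>j. to_ac k * a j) = fscale k (codeword a)"
proof
  fix i
  have "(\<lambda>j. to_ac k * a j) \<in> UNIV \<rightarrow> L" using assms by (auto intro: frob_fixed_mult to_ac_frob_fixed)
  moreover have "poly_value (\<lambda>j. to_ac k * a j) i = to_ac k * poly_value a i" for i
    by (simp add: poly_value_def mult.assoc sum_distrib_left)
  ultimately have "to_ac (codeword (\<lambda>j. to_ac k * a j) i) = to_ac (fscale k (codeword a) i)"
    using assms by (simp add: to_ac_codeword fscale_def rel_trace_scale mult.left_commute[of \<gamma>])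
  then show "codeword (\<lambda>j. to_ac k * a j) i = fscale k (codeword a) i" by (simp only: to_ac_eq_iff)
qed

lemma subspace_trace_code: "coord.subspace trace_code"
proof -
  have "codeword (\<lambda>_. 0) = 0"
    by (auto simp: codeword_def poly_value_def fun_eq_iff)
  then have "0 \<in> trace_code"
    unfolding trace_code_def by (intro image_eqI[of _ _ "\<lambda>_. 0"]) (auto simp: frob_fixed_0)
  moreover have "f + g \<in> trace_code" if fg: "f \<in> trace_code" "g \<in> trace_code" for f g
  proof -
    from fg obtain a b where "a \<in> UNIV \<rightarrow> L" "b \<in> UNIV \<rightarrow> L" "f = codeword a" "g = codeword b"
      by (auto simp: trace_code_def)
    then show ?thesis
      unfolding trace_code_def
      by (intro image_eqI[of _ _ "\<lambda>j. a j + b j"]) (auto simp: codeword_add intro: frob_fixed_add)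
  qed
  moreover have "fscale k f \<in> trace_code" if f: "f \<in> trace_code" for f k
  proof -
    from f obtain a where "a \<in> UNIV \<rightarrow> L" "f = codeword a" by (auto simp: trace_code_def)
    then show ?thesis
      unfolding trace_code_def
      by (intro image_eqI[of _ _ "\<lambda>j. to_ac k * a j"])
        (auto simp: codeword_scale intro: frob_fixed_mult to_ac_frob_fixed)
  qed
  ultimately show ?thesis by (simp add: coord.subspace_def)
qed

text \<open>A codeword depends only on the coefficients at \<open>exponents\<close>, and each
  coefficient has \<open>q^(2*m)\<close> possible values.\<close>

lemma card_trace_code: "card trace_code \<le> CARD('a) ^ (2 * m * card exponents)"
proof -
  have fin: "finite L" using m_pos by (simp add: finite_frob_fixed)
  have "codeword a = codeword (restrict a exponents)" for a
    by (simp add: codeword_def poly_value_def fun_eq_iff)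
  then have "trace_code \<subseteq> codeword ` (exponents \<rightarrow>\<^sub>E L)"
    unfolding trace_code_def
    by (intro image_subsetI image_eqI[where x = "restrict _ exponents"]) auto
  then have "card trace_code \<le> card (codeword ` (exponents \<rightarrow>\<^sub>E L))"
    using fin finite_exponents by (intro card_mono finite_imageI finite_PiE) auto
  also have "\<dots> \<le> card (exponents \<rightarrow>\<^sub>E L)"
    using fin finite_exponents by (intro card_image_le finite_PiE) auto
  also have "\<dots> = CARD('a) ^ (2 * m * card exponents)"
    using m_pos finite_exponents by (simp add: card_funcsetE card_frob_fixed power_mult)
  finally show ?thesis .
qed

lemma sum_\<alpha>_power_eq_0:
  assumes "\<not> n dvd k"
  shows "(\<Sum>i<n. \<alpha> i ^ k) = 0"
proof -
  have "card {x :: 'a alg_closure. x ^ n = 1} = n"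
    unfolding n_def using m_pos by (intro card_roots_of_unity_frob) simp
  then have "(\<Sum>x | x ^ n = (1 :: 'a alg_closure). x ^ k) = 0"
    using n_pos assms by (rule sum_roots_of_unity_power_eq_0)
  then show ?thesis
    using sum.reindex_bij_betw[OF \<alpha>, of "\<lambda>x. x ^ k"] by simp
qed

text \<open>Frobenius is additive, so the product expands into power sums of \<alpha> with exponents
  \<open>j * q^s + k * q^t\<close>. None of these is divisible by \<open>n\<close>, so every power
  sum is 0.\<close>

lemma poly_value_orthogonal:
  assumes "s < 2 * m" "t < 2 * m" "odd (s + t)"
  shows "(\<Sum>i<n. poly_value b i ^ (CARD('a) ^ s) * poly_value a i ^ (CARD('a) ^ t)) = 0"
proof -
  have "(\<Sum>i<n. poly_value b i ^ (CARD('a) ^ s) * poly_value a i ^ (CARD('a) ^ t)) =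
      (\<Sum>i<n. \<Sum>j\<in>exponents. \<Sum>k\<in>exponents.
        (b j ^ (CARD('a) ^ s) * a k ^ (CARD('a) ^ t)) * \<alpha> i ^ (j * CARD('a) ^ s + k * CARD('a) ^ t))"
    unfolding poly_value_def alg_closure_frobenius_sum sum_product
    by (intro sum.cong refl) (simp add: power_mult_distrib power_add power_mult ac_simps)
  also have "\<dots> = (\<Sum>j\<in>exponents. \<Sum>k\<in>exponents. \<Sum>i<n.
        (b j ^ (CARD('a) ^ s) * a k ^ (CARD('a) ^ t)) * \<alpha> i ^ (j * CARD('a) ^ s + k * CARD('a) ^ t))"
    by (subst sum.swap, rule sum.cong[OF refl], rule sum.swap)
  also have "\<dots> = 0"
  proof (rule sum.neutral, rule ballI, rule sum.neutral, rule ballI)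
    fix j k assume "j \<in> exponents" "k \<in> exponents"
    then have "\<not> n dvd (j * CARD('a) ^ s + k * CARD('a) ^ t)"
      unfolding n_def using assms m_pos q_gt_1 \<delta>_max
      by (intro bch_exponent_not_dvd[where \<delta> = \<delta>]) (auto simp: exponents_def)
    then show "(\<Sum>i<n. (b j ^ (CARD('a) ^ s) * a k ^ (CARD('a) ^ t)) * \<alpha> i ^ (j * CARD('a) ^ s + k * CARD('a) ^ t)) = 0"
      by (simp add: sum_\<alpha>_power_eq_0 flip: sum_distrib_left)
  qed
  finally show ?thesis .
qed

text \<open>In the double sum of \<open>rel_trace_antisymmetric\<close> the terms with even
  \<open>s + t\<close> vanish through \<gamma>, and those with odd \<open>s + t\<close> vanish
  through \<open>poly_value_orthogonal\<close>.\<close>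

lemma trace_code_isotropic: "trace_code \<subseteq> coord.perp n trace_code"
proof -
  have "codeword a \<in> coord_space (2 * n)" for a
    by (simp add: codeword_def coord_space_def)
  moreover have "sform n (codeword a) (codeword b) = 0"
    if ab: "a \<in> UNIV \<rightarrow> L" "b \<in> UNIV \<rightarrow> L" for a b
  proof -
    have "to_ac (sform n (codeword a) (codeword b)) =
        (\<Sum>i<n. Tr (poly_value b i) * Tr (\<gamma> * poly_value a i) -
          Tr (poly_value a i) * Tr (\<gamma> * poly_value b i))"
      using ab by (simp add: sform_def to_ac_sum to_ac_codeword)
    also have "\<dots> = (\<Sum>i<n. \<Sum>s<2*m. \<Sum>t<2*m. (\<gamma> ^ (CARD('a) ^ t) - \<gamma> ^ (CARD('a) ^ s)) *
        (poly_value b i ^ (CARD('a) ^ s) * poly_value a i ^ (CARD('a) ^ t)))"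
      by (simp add: rel_trace_antisymmetric)
    also have "\<dots> = (\<Sum>s<2*m. \<Sum>t<2*m. \<Sum>i<n. (\<gamma> ^ (CARD('a) ^ t) - \<gamma> ^ (CARD('a) ^ s)) *
        (poly_value b i ^ (CARD('a) ^ s) * poly_value a i ^ (CARD('a) ^ t)))"
      by (subst sum.swap, rule sum.cong[OF refl], rule sum.swap)
    also have "\<dots> = 0"
    proof (rule sum.neutral, rule ballI, rule sum.neutral, rule ballI)
      fix s t assume st: "s \<in> {..<2*m}" "t \<in> {..<2*m}"
      show "(\<Sum>i<n. (\<gamma> ^ (CARD('a) ^ t) - \<gamma> ^ (CARD('a) ^ s)) *
          (poly_value b i ^ (CARD('a) ^ s) * poly_value a i ^ (CARD('a) ^ t))) = 0"
      proof (cases "even (s + t)")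
        case True
        then show ?thesis unfolding frob_fixed_2_power_eq[OF \<gamma>(1) True] by simp
      next
        case False
        with st poly_value_orthogonal show ?thesis by (simp flip: sum_distrib_left)
      qed
    qed
    finally show ?thesis by simp
  qed
  ultimately show ?thesis by (auto simp: trace_code_def coord.perp_def)
qed

text \<open>This is the BCH bound for the word \<open>z\<close> over \<open>frob_fixed 2\<close>
  that encodes \<open>v\<close>: duality gives vanishing power sums \<open>Z j\<close> for
  \<open>0 < j < \<delta>\<close>, which exclude a nonzero word of weight less than
  \<delta>.\<close>

lemma trace_code_dual_distance:
  assumes v: "v \<in> coord.perp n trace_code"
    and wt: "card {i. i < n \<and> (v i, v (n + i)) \<noteq> (0, 0)} < \<delta>"
  shows "v = 0"
proof -
  \<comment> \<open>Chosen so that the \<open>i\<close>-th term of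
    \<open>sform n v (codeword a)\<close> becomes \<open>Tr (z i * poly_value a i)\<close>.\<close>
  define z where "z i = to_ac (v (n + i)) - to_ac (v i) * \<gamma>" for i
  define Z where "Z j = (\<Sum>i<n. z i * \<alpha> i ^ j)" for j
  have z_2: "z i \<in> frob_fixed 2" for i
    unfolding z_def by (intro frob_fixed_diff frob_fixed_mult to_ac_frob_fixed \<gamma>)
  have z_L: "z i \<in> L" for i
    using z_2 frob_fixed_mono[of 2 "2 * m"] by auto
  have Z_L: "Z j \<in> L" for j
    unfolding Z_def by (intro frob_fixed_sum frob_fixed_mult frob_fixed_power z_L \<alpha>_in_L) simp
  have orth: "Tr (\<Sum>j\<in>exponents. a j * Z j) = 0" if a: "a \<in> UNIV \<rightarrow> L" for a
  proof -
    have "sform n v (codeword a) = 0"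
      using v a by (auto simp: coord.perp_def trace_code_def)
    then have "0 = to_ac (sform n v (codeword a))" by simp
    also have "\<dots> = (\<Sum>i<n. to_ac (v (n + i)) * Tr (poly_value a i) - to_ac (v i) * Tr (\<gamma> * poly_value a i))"
      using a by (simp add: sform_def to_ac_sum to_ac_codeword mult.commute)
    also have "\<dots> = (\<Sum>i<n. Tr (z i * poly_value a i))"
      by (intro sum.cong refl)
        (simp add: z_def left_diff_distrib rel_trace_diff mult.assoc rel_trace_scale)
    also have "\<dots> = Tr (\<Sum>i<n. \<Sum>j\<in>exponents. a j * (z i * \<alpha> i ^ j))"
      by (simp add: rel_trace_sum poly_value_def sum_distrib_left mult.left_commute)
    also have "\<dots> = Tr (\<Sum>j\<in>exponents. a j * Z j)"
      by (subst sum.swap) (simp add: Z_def sum_distrib_left)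
    finally show ?thesis by simp
  qed
  \<comment> \<open>Coefficient families supported at the single exponent \<open>j\<close> separate
    the checks, and nondegeneracy of the trace removes \<open>Tr\<close>.\<close>
  have Z_exponent: "Z j = 0" if j: "j \<in> exponents" for j
  proof (rule rel_trace_nondegenerate[of "2 * m"])
    fix b assume b: "b \<in> L"
    have "0 = Tr (\<Sum>k\<in>exponents. (if k = j then b else 0) * Z k)"
      using b by (intro orth[symmetric]) (auto simp: frob_fixed_0)
    also have "(\<Sum>k\<in>exponents. (if k = j then b else 0) * Z k) = (\<Sum>k\<in>exponents. if k = j then b * Z k else 0)"
      by (intro sum.cong) auto
    also have "\<dots> = b * Z j" using j finite_exponents by simp
    finally show "Tr (b * Z j) = 0" by simp
  qed (use m_pos Z_L in auto)
  \<comment> \<open>At \<open>j = k * q^2\<close> the entries satisfy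
    \<open>z i ^ (q^2) = z i\<close>, so \<open>Z j\<close> is the \<open>q^2\<close>-th power of
    \<open>Z k\<close>, which is 0 by induction.\<close>
  have Z_0: "Z j = 0" if "0 < j" "j < \<delta>" for j
    using that
  proof (induction j rule: less_induct)
    case (less j)
    show ?case
    proof (cases "CARD('a) ^ 2 dvd j")
      case False
      with less.prems show ?thesis by (intro Z_exponent) (simp add: exponents_def)
    next
      case True
      then obtain k where k: "j = k * CARD('a) ^ 2" by (metis dvd_def mult.commute)
      have "CARD('a) ^ 2 > 1" using q_gt_1 by (intro one_less_power) auto
      then have "k < j" "0 < k" using k less.prems(1) by auto
      with less have "Z k = 0" by simp
      have "Z j = (\<Sum>i<n. (z i * \<alpha> i ^ k) ^ (CARD('a) ^ 2))"
        unfolding Z_def k using z_2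
        by (intro sum.cong refl) (simp add: power_mult_distrib power_mult frob_fixed_def)
      also have "\<dots> = Z k ^ (CARD('a) ^ 2)"
        by (simp only: Z_def alg_closure_frobenius_sum)
      finally show ?thesis using \<open>Z k = 0\<close> q_gt_1 by (simp add: power_0_left)
    qed
  qed
  have z_0: "z i = 0" if i0: "i < n" for i
  proof (rule ccontr)
    assume "z i \<noteq> 0"
    define I where "I = {k. k < n \<and> z k \<noteq> 0}"
    have I: "finite I" "i \<in> I" using i0 \<open>z i \<noteq> 0\<close> by (auto simp: I_def)
    have "card I \<le> card {i. i < n \<and> (v i, v (n + i)) \<noteq> (0, 0)}"
      by (intro card_mono) (auto simp: I_def z_def)
    with wt have card_I: "card I < \<delta>" by simp
    \<comment> \<open>The factor \<open>X\<close> is there because \<open>Z 0\<close> need not vanish.\<close>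
    define P where "P = [:0, 1:] * (\<Prod>k\<in>I - {i}. [:- \<alpha> k, 1:])"
    have "degree P \<le> 1 + (\<Sum>k\<in>I - {i}. degree [:- \<alpha> k, 1:])"
    proof -
      have "degree (\<Prod>k\<in>I - {i}. [:- \<alpha> k, 1:]) \<le> sum (degree \<circ> (\<lambda>k. [:- \<alpha> k, 1:])) (I - {i})"
        using I by (intro degree_prod_sum_le) simp
      moreover have "degree P \<le> degree [:0, 1 :: 'a alg_closure:] + degree (\<Prod>k\<in>I - {i}. [:- \<alpha> k, 1:])"
        unfolding P_def by (rule degree_mult_le)
      ultimately show ?thesis by (simp add: comp_def)
    qed
    also have "\<dots> = card I" using card_Suc_Diff1[OF I] by simp
    finally have deg: "degree P < \<delta>" using card_I by simp
    \<comment> \<open>This sum is evaluated twice. By coefficients it is a combination of vanishing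
      \<open>Z j\<close>; by points only \<open>k = i\<close> survives, since \<open>P\<close>
      vanishes at the rest of the support.\<close>
    have "(\<Sum>k<n. z k * poly P (\<alpha> k)) = (\<Sum>k<n. \<Sum>j\<le>degree P. coeff P j * (z k * \<alpha> k ^ j))"
      by (simp add: poly_altdef sum_distrib_left mult.left_commute)
    also have "\<dots> = (\<Sum>j\<le>degree P. coeff P j * Z j)"
      by (subst sum.swap) (simp add: Z_def sum_distrib_left)
    also have "\<dots> = 0"
    proof (intro sum.neutral ballI)
      fix j assume "j \<in> {..degree P}"
      then have "j < \<delta>" using deg by simp
      moreover have "coeff P 0 = 0" by (simp add: P_def coeff_mult)
      ultimately show "coeff P j * Z j = 0" using Z_0[of j] by (cases "j = 0") auto
    qed
    finally have "0 = (\<Sum>k<n. z k * poly P (\<alpha> k))" by simp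
    also have "\<dots> = (\<Sum>k<n. if k = i then z k * poly P (\<alpha> k) else 0)"
    proof (intro sum.cong refl)
      fix k assume "k \<in> {..<n}"
      then show "z k * poly P (\<alpha> k) = (if k = i then z k * poly P (\<alpha> k) else 0)"
        using I by (auto simp: P_def poly_prod I_def)
    qed
    also have "\<dots> = z i * poly P (\<alpha> i)" using i0 by simp
    finally have "poly P (\<alpha> i) = 0" using \<open>z i \<noteq> 0\<close> by simp
    then obtain k where "k \<in> I - {i}" "\<alpha> i = \<alpha> k"
      using I \<alpha>_nonzero[OF i0] by (auto simp: P_def poly_prod)
    then show False
      using \<alpha> i0 by (auto simp: bij_betw_def inj_on_def I_def)
  qed
  have v_0: "v i = 0 \<and> v (n + i) = 0" if "i < n" for i
  proof -
    have eq: "to_ac (v (n + i)) = to_ac (v i) * \<gamma>"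
      using z_0[OF that] by (simp add: z_def)
    \<comment> \<open>Otherwise \<gamma> would be a quotient of base field elements.\<close>
    have "v i = 0"
    proof (rule ccontr)
      assume "v i \<noteq> 0"
      then have "\<gamma> = to_ac (v (n + i) / v i)" using eq by (simp add: field_simps)
      then show False using \<gamma>(2) to_ac_frob_fixed by metis
    qed
    with eq show ?thesis by simp
  qed
  moreover have "i < n \<or> i = n + (i - n) \<and> i - n < n \<or> 2 * n \<le> i" for i by linarith
  moreover have "v \<in> coord_space (2 * n)" using v by (simp add: coord.perp_def)
  ultimately have "v i = 0" for i
    by (metis (mono_tags, lifting) coord_space_def mem_Collect_eq)
  then show ?thesis by (simp add: fun_eq_iff)
qed

end

section \<open>Subsystem codes\<close>

theorem corollary17:
  fixes q m n k r \<delta> :: nat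
  assumes "CARD('a :: finite_field) = q"
    and "m > 0"
    and "2 \<le> \<delta>"
    and "int \<delta> \<le> int q ^ (m + of_bool (even m)) - 1 - (int q ^ 2 - 2) * of_bool (even m)"
    and "n = q ^ (2 * m) - 1"
    and "int r < int n - 2 * int m * \<lceil>(real \<delta> - 1) * (1 - 1 / real q ^ 2)\<rceil>"
    and "int k = int n - 2 * int m * \<lceil>(real \<delta> - 1) * (1 - 1 / real q ^ 2)\<rceil> - int r"
  shows "\<exists>(C :: 'a vec set) d. is_subsystem_code_dim n k r d C \<and> d \<ge> \<delta> \<and> pure_to n \<delta> C"
proof -
  note q = assms(1)
  have q_gt_1: "q > 1" using card_finite_field_gt_1[where ?'a = 'a] q by simp
  have n_CARD: "n = CARD('a) ^ (2 * m) - 1" using assms(5) q by simp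

  have "q ^ 1 < q ^ 2" using q_gt_1 by (intro power_strict_increasing) auto
  then have "card (frob_fixed 1 :: 'a alg_closure set) < card (frob_fixed 2 :: 'a alg_closure set)"
    using q by (simp add: card_frob_fixed)
  then have "\<not> (frob_fixed 2 :: 'a alg_closure set) \<subseteq> frob_fixed 1"
    using card_mono[OF finite_frob_fixed[of 1], of "frob_fixed 2 :: 'a alg_closure set"] by auto
  then obtain \<gamma> :: "'a alg_closure" where \<gamma>: "\<gamma> \<in> frob_fixed 2" "\<gamma> \<notin> frob_fixed 1" by blast

  let ?U = "{x :: 'a alg_closure. x ^ n = 1}"
  have card_U: "card ?U = n"
    unfolding n_CARD using assms(2) by (intro card_roots_of_unity_frob) simp
  have n_pos: "n > 0"
    using one_less_power[OF q_gt_1, of "2 * m"] assms(2,5) by simp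
  with card_U have "finite ?U" by (intro card_ge_0_finite) simp
  then obtain \<alpha> where "bij_betw \<alpha> {0..<card ?U} ?U"
    using ex_bij_betw_nat_finite by blast
  then have \<alpha>: "bij_betw \<alpha> {..<n} ?U" by (simp only: card_U atLeast0LessThan)

  interpret bch m n \<delta> \<gamma> \<alpha>
    by unfold_locales (use assms(2,4) q n_CARD \<gamma> \<alpha> in simp_all)

  \<comment> \<open>The ceiling bounds a cardinality from above, so it is nonnegative and
    \<open>nat\<close> does not truncate it.\<close>
  define c where "c = nat \<lceil>(real \<delta> - 1) * (1 - 1 / real q ^ 2)\<rceil>"
  define s where "s = 2 * m * c"
  have "int (card exponents) \<le> \<lceil>(real \<delta> - 1) * (1 - 1 / real q ^ 2)\<rceil>"
    using card_not_multiples_le[of "q ^ 2" \<delta>] q_gt_1 assms(3) q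
    by (simp add: exponents_def)
  then have card_exp: "card exponents \<le> c"
    and c: "int c = \<lceil>(real \<delta> - 1) * (1 - 1 / real q ^ 2)\<rceil>"
    unfolding c_def by linarith+
  have "int s + int r < int n" "int k = int n - int s - int r"
    using assms(6,7) unfolding c[symmetric] s_def by simp_all
  then have n_sum: "n = s + r + k" and k_pos: "k > 0" by linarith+

  have "card trace_code \<le> CARD('a) ^ (2 * m * card exponents)" by (rule card_trace_code)
  also have "\<dots> \<le> CARD('a) ^ s"
    unfolding s_def using card_exp q_gt_1 q by (intro power_increasing) auto
  \<comment> \<open>The trace code is padded to dimension exactly \<open>s\<close>; the ambient
    dimension is \<open>2 * n\<close>, and \<open>s \<le> n\<close> leaves room for this.\<close>
  finally obtain D where D: "coord.subspace D" "trace_code \<subseteq> D" "D \<subseteq> coord.perp n D" "card D = CARD('a) ^ s"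
    using coord.isotropic_extension[OF subspace_trace_code trace_code_isotropic, of s] n_sum by auto
  obtain C where C: "coord.subspace C" "C \<subseteq> coord_space (2 * n)" "C \<inter> coord.perp n C = D"
      "card C = CARD('a) ^ (s + 2 * r)"
    using coord.gauge_extension[OF D(1,3,4), of r] n_sum by auto

  let ?v = "vec (2 * n) :: (nat \<Rightarrow> 'a) \<Rightarrow> 'a vec"
  define E where "E = coord.perp n D"
  have D_space: "D \<subseteq> coord_space (2 * n)" using C(2,3) by blast
  have E_space: "E \<subseteq> coord_space (2 * n)" unfolding E_def by (rule coord.perp_subset)
  have "C \<subseteq> E"
  proof -
    have "D \<subseteq> coord.perp n C" using C(3) by blast
    then have "coord.perp n (coord.perp n C) \<subseteq> E" unfolding E_def by (rule coord.perp_antimono)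
    then show ?thesis using coord.subset_perp_perp[OF C(2)] by blast
  qed
  have "card E = CARD('a) ^ (2 * n - s)"
    unfolding E_def using D(1) D_space D(4) by (rule coord.card_perp)
  \<comment> \<open>Here \<open>2 * n - s = s + 2 * r + 2 * k\<close>, so \<open>k > 0\<close> makes
    \<open>C\<close> a proper subset of \<open>E\<close>; the distance is then taken over the
    difference.\<close>
  moreover have "CARD('a) ^ (s + 2 * r) < CARD('a) ^ (2 * n - s)"
    using n_sum k_pos q_gt_1 q by (intro power_strict_increasing) auto
  ultimately have card_CE: "card C < card E" using C(4) by simp

  \<comment> \<open>This one bound yields both the distance, over \<open>E - C\<close>, and purity,
    over \<open>C\<close>, since \<open>C \<subseteq> E\<close>.\<close>
  have wt: "swt n w \<ge> \<delta>" if w: "w \<in> ?v ` E" "w \<noteq> 0\<^sub>v (2 * n)" for w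
  proof (rule ccontr)
    assume less: "\<not> \<delta> \<le> swt n w"
    from w obtain f where f: "f \<in> E" "w = ?v f" by blast
    have "f \<in> coord.perp n trace_code"
      using f(1) coord.perp_antimono[OF D(2)] unfolding E_def by blast
    moreover have "card {i. i < n \<and> (f i, f (n + i)) \<noteq> (0, 0)} < \<delta>"
      using less unfolding f(2) swt_vec by simp
    ultimately have "f = 0" by (rule trace_code_dual_distance)
    then have "w = 0\<^sub>v (2 * n)" unfolding f(2) by auto
    with w(2) show False by blast
  qed

  have inj_E: "inj_on ?v E" using inj_on_vec E_space by (rule inj_on_subset)
  have C': "symplectic_dual n (?v ` C) = ?v ` coord.perp n C"
    using C(1) by (rule symplectic_dual_vec_image)
  have D': "?v ` C \<inter> symplectic_dual n (?v ` C) = ?v ` D"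
    unfolding C' using inj_on_image_Int[OF inj_on_vec C(2) coord.perp_subset] C(3) by metis
  have E': "symplectic_dual n (?v ` D) = ?v ` E"
    unfolding E_def using D(1) by (rule symplectic_dual_vec_image)
  have card_C: "card (?v ` C) = CARD('a) ^ (s + 2 * r)"
    using C(4) inj_on_subset[OF inj_E \<open>C \<subseteq> E\<close>] by (simp add: card_image)
  have card_D: "card (?v ` D) = CARD('a) ^ s"
    using D(4) inj_on_subset[OF inj_on_vec D_space] by (simp add: card_image)
  have "card (?v ` C) < card (?v ` E)"
    using card_CE inj_E inj_on_subset[OF inj_E \<open>C \<subseteq> E\<close>] by (simp add: card_image)
  then have "?v ` E \<noteq> ?v ` C" by auto
  define W where "W = swt n ` ((?v ` E - ?v ` C) - {0\<^sub>v (2 * n)})"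
  \<comment> \<open>\<open>Min\<close> is meaningful here: \<open>W\<close> is finite, and it is
    nonempty because \<open>E\<close> exceeds \<open>C\<close> while the zero vector lies in
    \<open>C\<close>.\<close>
  define d where "d = Min W"
  have "finite E" using E_space coord.finite_V by (rule finite_subset)
  then have fin_W: "finite W" unfolding W_def by simp
  have "0 \<in> C" using C(1) by (rule coord.subspace_0)
  then have "0\<^sub>v (2 * n) \<in> ?v ` C" by (intro image_eqI[of _ _ 0]) auto
  have "?v ` C \<subseteq> ?v ` E" using \<open>C \<subseteq> E\<close> by (rule image_mono)
  with \<open>?v ` E \<noteq> ?v ` C\<close> obtain w where w: "w \<in> ?v ` E" "w \<notin> ?v ` C"
    by (metis subsetI subset_antisym)
  with \<open>0\<^sub>v (2 * n) \<in> ?v ` C\<close> have "w \<noteq> 0\<^sub>v (2 * n)" by metis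
  with w have "swt n w \<in> W" unfolding W_def by (intro imageI DiffI) simp_all
  then have "W \<noteq> {}" by (metis empty_iff)
  then have "d \<in> W" unfolding d_def using fin_W by (rule Min_in[rotated])
  then obtain w where "d = swt n w" "w \<in> ?v ` E" "w \<noteq> 0\<^sub>v (2 * n)"
    unfolding W_def by (elim imageE DiffE) simp
  then have d: "d \<ge> \<delta>" using wt by metis

  have "is_subsystem_code_dim n k r d (?v ` C)"
    unfolding is_subsystem_code_dim_def is_subsystem_code_def Let_def D' E'
  proof (intro conjI)
    show "additive_subgroup (?v ` C) (module_vec TYPE('a) (2 * n))"
      using C(1) by (rule additive_subgroup_vec_image)
    \<comment> \<open>With \<open>n = s + r + k\<close> the exponents agree:
      \<open>n + r - k = s + 2 * r\<close> for \<open>C\<close>, and \<open>n - k - r = s\<close>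
      for \<open>D\<close>.\<close>
    show "real (card (?v ` C)) = real CARD('a) ^ n * real (CARD('a) ^ r) / real (CARD('a) ^ k)"
      unfolding card_C unfolding n_sum using q_gt_1 q by (simp add: power_add mult_2)
    show "real (card (?v ` D)) = real CARD('a) ^ n / (real (CARD('a) ^ k) * real (CARD('a) ^ r))"
      unfolding card_D unfolding n_sum using q_gt_1 q by (simp add: power_add)
    show "d = (if ?v ` E \<noteq> ?v ` C then swt_set n (?v ` E - ?v ` C) else swt_set n (?v ` E))"
      using \<open>?v ` E \<noteq> ?v ` C\<close> by (simp add: d_def W_def swt_set_def)
  qed
  moreover have "pure_to n \<delta> (?v ` C)"
    unfolding pure_to_def using wt \<open>?v ` C \<subseteq> ?v ` E\<close> by (metis linorder_not_le subsetD)
  ultimately show ?thesis using d by blast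
qed

end
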